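(* Let $L$ be an even unimodular lattice, $g\in\mathrm{Aut}(L)$ of order $n$, $N=L_g^\perp/L(1-g)$, and let $C:N\times N\to\mathbb C^*$ be the non-degenerate alternating bimultiplicative form induced by $$C(\alpha,\beta)=\prod_{k=0}^{n-1}(-\xi_n^k)^{-\langle\alpha g^k|\beta\rangle},\qquad \alpha,\beta\in L_g^\perp .$$ Let $A\le N$ be a subgroup with character group $\check A$, and $\gamma:N\to A\oplus\check A$ an isomorphism such that $C(\gamma^{-1}(x,\chi),\gamma^{-1}(y,\psi))=\psi(x)\chi(y)^{-1}$ for all $x,y\in A$, $\chi,\psi\in\check A$. Then, up to projective equivalence, the unique irreducible projective representation $(\rho,\Omega_0)$ of $N$ such that the skew of its $2$-cocycle is $C$ is given (identifying $N$ with $A\oplus\check A$ via $\gamma$) by $$\rho(x,\chi)e_\psi=\psi(x)\,e_{\chi\psi},\qquad x\in A,\ \chi,\psi\in\check A,$$ where $\Omega_0$ is the complex vector space with basis $\{e_\chi:\chi\in\check A\}$.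
   Context: Automorphisms of $L$ act on the right, $\langle\cdot|\cdot\rangle$ is the inner product, $\xi_n$ is a primitive $n$-th root of unity. $L_g^\perp$ is the sublattice of $L$ of vectors orthogonal to the $g$-fixed subspace of $L\otimes\mathbb R$, and $L(1-g)=\{\alpha-\alpha g:\alpha\in L\}\subset L_g^\perp$; $N$ is a finite abelian group. It is known that $C$ descends to a non-degenerate alternating bimultiplicative form on $N$ and that a decomposition $(A,\gamma)$ as in the claim exists. $\check A=\mathrm{Hom}(A,\mathbb C^* )$. A projective representation $\rho$ of $N$ satisfies $\rho(\mu)\rho(\nu)=c(\mu,\nu)\rho(\mu+\nu)$ for a $2$-cocycle $c:N\times N\to\mathbb C^*$; the skew of $c$ is $c(\mu,\nu)/c(\nu,\mu)$, i.e. $\rho(\mu)\rho(\nu)\rho(\mu)^{-1}\rho(\nu)^{-1}$. Two projective representations $\rho,\rho'$ are projectively equivalent if there are a linear isomorphism $T$ and a function $\lambda:N\to\mathbb C^*$ with $T\rho(\mu)T^{-1}=\lambda(\mu)\rho'(\mu)$ for all $\mu$. *)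

theory Defs
  imports
    Complex_Main
    "HOL-Algebra.Coset"
    "HOL-Library.Function_Algebras"
begin

text \<open>
  The type \<open>'v\<close> plays the role of \<open>L \<otimes> \<real>\<close>: a lattice \<open>L\<close> is the set of integral
  combinations of a finite real basis of \<open>'v\<close>, and its form \<open>b\<close> and its automorphisms are given by
  their (unique) \<open>\<real>\<close>-linear extensions to \<open>'v\<close>.  The form has to be non-degenerate; it is not
  required to be definite.  The right action \<open>\<alpha> g\<close> of an automorphism is written \<open>g \<alpha>\<close>.
\<close>

definition is_lattice :: "('v::real_vector \<Rightarrow> 'v \<Rightarrow> real) \<Rightarrow> 'v set \<Rightarrow> bool" where
  "is_lattice b L \<longleftrightarrow>
     (\<exists>B. finite B \<and> independent B \<and> span B = UNIV \<and>
          L = {\<Sum>v\<in>B. of_int (c v) *\<^sub>R v | c :: 'v \<Rightarrow> int. True}) \<and>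
     (\<forall>x. linear (b x)) \<and> (\<forall>x y. b x y = b y x) \<and>
     (\<forall>x. (\<forall>y. b x y = 0) \<longrightarrow> x = 0)"

definition even_lattice :: "('v::real_vector \<Rightarrow> 'v \<Rightarrow> real) \<Rightarrow> 'v set \<Rightarrow> bool" where
  "even_lattice b L \<longleftrightarrow>
     is_lattice b L \<and> (\<forall>x\<in>L. \<forall>y\<in>L. b x y \<in> \<int>) \<and> (\<forall>x\<in>L. \<exists>m::int. b x x = 2 * of_int m)"

definition dual_lattice :: "('v::real_vector \<Rightarrow> 'v \<Rightarrow> real) \<Rightarrow> 'v set \<Rightarrow> 'v set" where
  "dual_lattice b L = {x. \<forall>y\<in>L. b x y \<in> \<int>}"

definition unimodular :: "('v::real_vector \<Rightarrow> 'v \<Rightarrow> real) \<Rightarrow> 'v set \<Rightarrow> bool" where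
  "unimodular b L \<longleftrightarrow> dual_lattice b L = L"

definition lattice_aut ::
    "('v::real_vector \<Rightarrow> 'v \<Rightarrow> real) \<Rightarrow> 'v set \<Rightarrow> ('v \<Rightarrow> 'v) \<Rightarrow> bool" where
  "lattice_aut b L g \<longleftrightarrow> linear g \<and> bij g \<and> g ` L = L \<and> (\<forall>x y. b (g x) (g y) = b x y)"

definition has_order :: "('v \<Rightarrow> 'v) \<Rightarrow> nat \<Rightarrow> bool" where
  "has_order g n \<longleftrightarrow> 0 < n \<and> g ^^ n = id \<and> (\<forall>k. 0 < k \<and> k < n \<longrightarrow> g ^^ k \<noteq> id)"

definition primitive_root_of_unity :: "nat \<Rightarrow> complex \<Rightarrow> bool" where
  "primitive_root_of_unity n \<xi> \<longleftrightarrow>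
     0 < n \<and> \<xi> ^ n = 1 \<and> (\<forall>k. 0 < k \<and> k < n \<longrightarrow> \<xi> ^ k \<noteq> 1)"

definition coinvariant_lattice ::
    "('v::real_vector \<Rightarrow> 'v \<Rightarrow> real) \<Rightarrow> 'v set \<Rightarrow> ('v \<Rightarrow> 'v) \<Rightarrow> 'v set" where
  "coinvariant_lattice b L g = {\<alpha> \<in> L. \<forall>v. g v = v \<longrightarrow> b \<alpha> v = 0}"

text \<open>The additive group of \<open>'v\<close>, restricted to a subset, as a structure of HOL-Algebra.\<close>

definition add_group :: "'v::ab_group_add set \<Rightarrow> 'v monoid" where
  "add_group M = \<lparr>carrier = M, monoid.mult = (+), one = 0\<rparr>"

definition N_group ::
    "('v::real_vector \<Rightarrow> 'v \<Rightarrow> real) \<Rightarrow> 'v set \<Rightarrow> ('v \<Rightarrow> 'v) \<Rightarrow> 'v set monoid" where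
  "N_group b L g = add_group (coinvariant_lattice b L g) Mod ((\<lambda>\<alpha>. \<alpha> - g \<alpha>) ` L)"

text \<open>The floor only converts the integer \<open>b (\<alpha> g\<^sup>k) \<beta>\<close> from type \<open>real\<close> to type \<open>int\<close>.\<close>

definition C_lattice ::
    "('v::real_vector \<Rightarrow> 'v \<Rightarrow> real) \<Rightarrow> ('v \<Rightarrow> 'v) \<Rightarrow> nat \<Rightarrow> complex \<Rightarrow> 'v \<Rightarrow> 'v \<Rightarrow> complex" where
  "C_lattice b g n \<xi> \<alpha> \<beta> = (\<Prod>k<n. (- (\<xi> ^ k)) powi (- \<lfloor>b ((g ^^ k) \<alpha>) \<beta>\<rfloor>))"

text \<open>
  The form induced on \<open>N\<close>: the common value of \<open>C_lattice\<close> on all representatives of two cosets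
  (see the lemma \<open>C_form_coset\<close> below for the independence of the choice).
\<close>

definition C_form ::
    "('v::real_vector \<Rightarrow> 'v \<Rightarrow> real) \<Rightarrow> ('v \<Rightarrow> 'v) \<Rightarrow> nat \<Rightarrow> complex \<Rightarrow> 'v set \<Rightarrow> 'v set \<Rightarrow> complex" where
  "C_form b g n \<xi> \<mu> \<nu> = (THE z. \<forall>\<alpha>\<in>\<mu>. \<forall>\<beta>\<in>\<nu>. C_lattice b g n \<xi> \<alpha> \<beta> = z)"

definition complex_units :: "complex monoid" where
  "complex_units = \<lparr>carrier = - {0}, monoid.mult = (*), one = 1\<rparr>"

text \<open>Characters are extended by \<open>undefined\<close> outside the carrier, so that equality of characters
  is equality of functions.\<close>

definition char_group :: "('a, 'm) monoid_scheme \<Rightarrow> ('a \<Rightarrow> complex) monoid" where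
  "char_group G =
     \<lparr>carrier = hom G complex_units \<inter> extensional (carrier G),
      monoid.mult = (\<lambda>\<chi> \<psi>. \<lambda>x\<in>carrier G. \<chi> x * \<psi> x),
      one = (\<lambda>x\<in>carrier G. 1)\<rparr>"

text \<open>
  A complex vector space is a subspace \<open>W\<close> of a type with a scalar multiplication \<open>s\<close>; no
  dimension is bounded.
\<close>

definition cvector_space :: "(complex \<Rightarrow> 'w::ab_group_add \<Rightarrow> 'w) \<Rightarrow> 'w set \<Rightarrow> bool" where
  "cvector_space s W \<longleftrightarrow> vector_space s \<and> module.subspace s W"

definition clinear_iso ::
    "(complex \<Rightarrow> 'w::ab_group_add \<Rightarrow> 'w) \<Rightarrow> 'w set \<Rightarrow>
     (complex \<Rightarrow> 'u::ab_group_add \<Rightarrow> 'u) \<Rightarrow> 'u set \<Rightarrow> ('w \<Rightarrow> 'u) \<Rightarrow> bool" where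
  "clinear_iso s W s' W' T \<longleftrightarrow>
     bij_betw T W W' \<and> (\<forall>v\<in>W. \<forall>w\<in>W. T (v + w) = T v + T w) \<and> (\<forall>a. \<forall>w\<in>W. T (s a w) = s' a (T w))"

definition two_cocycle :: "('n, 'm) monoid_scheme \<Rightarrow> ('n \<Rightarrow> 'n \<Rightarrow> complex) \<Rightarrow> bool" where
  "two_cocycle N c \<longleftrightarrow>
     (\<forall>\<mu>\<in>carrier N. \<forall>\<nu>\<in>carrier N. c \<mu> \<nu> \<noteq> 0) \<and>
     (\<forall>\<mu>\<in>carrier N. \<forall>\<nu>\<in>carrier N. \<forall>\<kappa>\<in>carrier N.
        c \<mu> \<nu> * c (\<mu> \<otimes>\<^bsub>N\<^esub> \<nu>) \<kappa> = c \<nu> \<kappa> * c \<mu> (\<nu> \<otimes>\<^bsub>N\<^esub> \<kappa>))"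

definition projective_rep ::
    "('n, 'm) monoid_scheme \<Rightarrow> ('n \<Rightarrow> 'n \<Rightarrow> complex) \<Rightarrow>
     (complex \<Rightarrow> 'w::ab_group_add \<Rightarrow> 'w) \<Rightarrow> 'w set \<Rightarrow> ('n \<Rightarrow> 'w \<Rightarrow> 'w) \<Rightarrow> bool" where
  "projective_rep N c s W \<rho> \<longleftrightarrow>
     cvector_space s W \<and> two_cocycle N c \<and> (\<forall>\<mu>\<in>carrier N. clinear_iso s W s W (\<rho> \<mu>)) \<and>
     (\<forall>\<mu>\<in>carrier N. \<forall>\<nu>\<in>carrier N. \<forall>w\<in>W. \<rho> \<mu> (\<rho> \<nu> w) = s (c \<mu> \<nu>) (\<rho> (\<mu> \<otimes>\<^bsub>N\<^esub> \<nu>) w))"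

definition irreducible_rep ::
    "('n, 'm) monoid_scheme \<Rightarrow> (complex \<Rightarrow> 'w::ab_group_add \<Rightarrow> 'w) \<Rightarrow> 'w set \<Rightarrow>
     ('n \<Rightarrow> 'w \<Rightarrow> 'w) \<Rightarrow> bool" where
  "irreducible_rep N s W \<rho> \<longleftrightarrow>
     W \<noteq> {0} \<and>
     (\<forall>U\<subseteq>W. module.subspace s U \<and> (\<forall>\<mu>\<in>carrier N. \<rho> \<mu> ` U \<subseteq> U) \<longrightarrow> U = {0} \<or> U = W)"

definition has_skew ::
    "('n, 'm) monoid_scheme \<Rightarrow> ('n \<Rightarrow> 'n \<Rightarrow> complex) \<Rightarrow> ('n \<Rightarrow> 'n \<Rightarrow> complex) \<Rightarrow> bool" where
  "has_skew N c C \<longleftrightarrow> (\<forall>\<mu>\<in>carrier N. \<forall>\<nu>\<in>carrier N. c \<mu> \<nu> / c \<nu> \<mu> = C \<mu> \<nu>)"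

definition irreducible_projective_rep_with_skew ::
    "('n, 'm) monoid_scheme \<Rightarrow> ('n \<Rightarrow> 'n \<Rightarrow> complex) \<Rightarrow>
     (complex \<Rightarrow> 'w::ab_group_add \<Rightarrow> 'w) \<Rightarrow> 'w set \<Rightarrow> ('n \<Rightarrow> 'w \<Rightarrow> 'w) \<Rightarrow> bool" where
  "irreducible_projective_rep_with_skew N C s W \<rho> \<longleftrightarrow>
     irreducible_rep N s W \<rho> \<and> (\<exists>c. projective_rep N c s W \<rho> \<and> has_skew N c C)"

definition projectively_equivalent ::
    "('n, 'm) monoid_scheme \<Rightarrow>
     (complex \<Rightarrow> 'w::ab_group_add \<Rightarrow> 'w) \<Rightarrow> 'w set \<Rightarrow> ('n \<Rightarrow> 'w \<Rightarrow> 'w) \<Rightarrow>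
     (complex \<Rightarrow> 'u::ab_group_add \<Rightarrow> 'u) \<Rightarrow> 'u set \<Rightarrow> ('n \<Rightarrow> 'u \<Rightarrow> 'u) \<Rightarrow> bool" where
  "projectively_equivalent N s W \<rho> s' W' \<rho>' \<longleftrightarrow>
     (\<exists>T l. clinear_iso s W s' W' T \<and>
        (\<forall>\<mu>\<in>carrier N. l \<mu> \<noteq> 0 \<and> (\<forall>w\<in>W. T (\<rho> \<mu> w) = s' (l \<mu>) (\<rho>' \<mu> (T w)))))"

definition fun_scale :: "complex \<Rightarrow> ('i \<Rightarrow> complex) \<Rightarrow> 'i \<Rightarrow> complex" where
  "fun_scale a f = (\<lambda>i. a * f i)"

definition basis_vec :: "'i \<Rightarrow> 'i \<Rightarrow> complex" where
  "basis_vec i = (\<lambda>j. if j = i then 1 else 0)"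

text \<open>The free complex vector space on \<open>X\<close>, as finitely supported functions.\<close>

definition free_space :: "'i set \<Rightarrow> ('i \<Rightarrow> complex) set" where
  "free_space X = {f. finite {i. f i \<noteq> 0} \<and> {i. f i \<noteq> 0} \<subseteq> X}"

definition linear_extension ::
    "('i \<Rightarrow> 'j \<Rightarrow> complex) \<Rightarrow> ('i \<Rightarrow> complex) \<Rightarrow> 'j \<Rightarrow> complex" where
  "linear_extension v f = (\<Sum>i | f i \<noteq> 0. fun_scale (f i) (v i))"

definition Omega0 :: "('a, 'm) monoid_scheme \<Rightarrow> (('a \<Rightarrow> complex) \<Rightarrow> complex) set" where
  "Omega0 A = free_space (carrier (char_group A))"

definition rho0 ::
    "('a, 'm) monoid_scheme \<Rightarrow> 'a \<times> ('a \<Rightarrow> complex) \<Rightarrow>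
     (('a \<Rightarrow> complex) \<Rightarrow> complex) \<Rightarrow> ('a \<Rightarrow> complex) \<Rightarrow> complex" where
  "rho0 A = (\<lambda>(x, \<chi>).
     linear_extension (\<lambda>\<psi>. fun_scale (\<psi> x) (basis_vec (\<chi> \<otimes>\<^bsub>char_group A\<^esub> \<psi>))))"

lemma vector_space_fun_scale: "vector_space fun_scale"
  by unfold_locales (auto simp: fun_scale_def plus_fun_def algebra_simps)

lemma free_space_eq_span: "free_space X = module.span fun_scale (basis_vec ` X)"
proof -
  interpret vector_space fun_scale by (rule vector_space_fun_scale)
  show ?thesis
  proof (intro equalityI subsetI)
    fix f assume "f \<in> free_space X"
    then have f: "finite {i. f i \<noteq> 0}" "{i. f i \<noteq> 0} \<subseteq> X" by (auto simp: free_space_def)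
    have "f = (\<Sum>i | f i \<noteq> 0. fun_scale (f i) (basis_vec i))"
    proof
      fix j
      have "(\<Sum>i | f i \<noteq> 0. fun_scale (f i) (basis_vec i)) j
            = (\<Sum>i | f i \<noteq> 0. fun_scale (f i) (basis_vec i) j)"
        using f(1) by (induction rule: finite_induct) auto
      also have "\<dots> = (\<Sum>i | f i \<noteq> 0. if j = i then f i else 0)"
        by (rule sum.cong) (auto simp: fun_scale_def basis_vec_def)
      also have "\<dots> = f j" using f(1) by simp
      finally show "f j = (\<Sum>i | f i \<noteq> 0. fun_scale (f i) (basis_vec i)) j" by simp
    qed
    also have "\<dots> \<in> span (basis_vec ` X)"
      using f(2) by (intro span_sum span_scale span_base) auto
    finally show "f \<in> span (basis_vec ` X)" .
  next
    fix f assume "f \<in> span (basis_vec ` X)"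
    then show "f \<in> free_space X"
    proof (induction rule: span_induct_alt)
      case base
      then show ?case by (simp add: free_space_def)
    next
      case (step c x y)
      then obtain i where i: "i \<in> X" "x = basis_vec i" by auto
      have sub: "{j. (fun_scale c x + y) j \<noteq> 0} \<subseteq> insert i {j. y j \<noteq> 0}"
        by (auto simp: i fun_scale_def basis_vec_def)
      have y: "finite {j. y j \<noteq> 0}" "{j. y j \<noteq> 0} \<subseteq> X"
        using step by (auto simp: free_space_def)
      have "insert i {j. y j \<noteq> 0} \<subseteq> X" using y(2) i(1) by blast
      with sub have "{j. (fun_scale c x + y) j \<noteq> 0} \<subseteq> X" by (rule subset_trans)
      moreover have "finite {j. (fun_scale c x + y) j \<noteq> 0}"
        by (rule finite_subset[OF sub]) (simp add: y(1))
      ultimately show ?case unfolding free_space_def by blast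
    qed
  qed
qed

lemma rho0_basis_vec:
  "rho0 A (x, \<chi>) (basis_vec \<psi>) = fun_scale (\<psi> x) (basis_vec (\<chi> \<otimes>\<^bsub>char_group A\<^esub> \<psi>))"
proof -
  have "{i. basis_vec \<psi> i \<noteq> 0} = {\<psi>}" by (auto simp: basis_vec_def)
  then show ?thesis by (simp add: rho0_def linear_extension_def fun_scale_def basis_vec_def)
qed

lemma telescoping_powi_prod:
  fixes \<xi> :: complex and a :: "nat \<Rightarrow> int"
  assumes "0 < n" "\<xi> ^ n = 1" "a n = a 0" "(\<Sum>k<n. a k) = 0"
  shows "(\<Prod>k<n. (- (\<xi> ^ k)) powi (- (a k - a (Suc k)))) = 1"
proof -
  have nz: "\<xi> \<noteq> 0" using assms(1,2) by (auto simp: power_0_left)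
  define F where "F k = (- (\<xi> ^ k)) powi (a k)" for k
  have Fnz: "F k \<noteq> 0" for k by (simp add: F_def nz)
  have "(\<Prod>k<m. (- (\<xi> ^ k)) powi (- (a k - a (Suc k))))
        = F m / F 0 * \<xi> powi (- (\<Sum>k<m. a (Suc k)))" for m
  proof (induction m)
    case 0
    then show ?case using Fnz by simp
  next
    case (Suc m)
    have "- (\<xi> ^ Suc m) = (- (\<xi> ^ m)) * \<xi>" by simp
    then have "F (Suc m) = (- (\<xi> ^ m)) powi (a (Suc m)) * \<xi> powi (a (Suc m))"
      unfolding F_def by (simp only: power_int_mult_distrib)
    then have 1: "(- (\<xi> ^ m)) powi (a (Suc m)) = F (Suc m) / \<xi> powi (a (Suc m))"
      using nz by simp
    have 2: "(- (\<xi> ^ m)) powi (- (a m - a (Suc m))) = (- (\<xi> ^ m)) powi (a (Suc m)) / F m"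
      using power_int_diff[of "- (\<xi> ^ m)" "a (Suc m)" "a m"] nz by (simp add: F_def)
    have 3: "\<xi> powi (- (\<Sum>k<Suc m. a (Suc k)))
             = \<xi> powi (- (\<Sum>k<m. a (Suc k))) / \<xi> powi (a (Suc m))"
    proof -
      have "- (\<Sum>k<Suc m. a (Suc k)) = - (\<Sum>k<m. a (Suc k)) - a (Suc m)" by simp
      then show ?thesis using nz by (simp only: power_int_diff disj_not1 simp_thms)
    qed
    have "(\<Prod>k<Suc m. (- (\<xi> ^ k)) powi (- (a k - a (Suc k))))
          = F m / F 0 * \<xi> powi (- (\<Sum>k<m. a (Suc k))) * (F (Suc m) / \<xi> powi (a (Suc m)) / F m)"
      unfolding prod.lessThan_Suc Suc.IH 2 1 ..
    also have "\<dots> = F (Suc m) / F 0 * (\<xi> powi (- (\<Sum>k<m. a (Suc k))) / \<xi> powi (a (Suc m)))"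
      using Fnz[of m] by simp
    finally show ?case unfolding 3 .
  qed
  note P = this[of n]
  have "(\<Sum>k<n. a (Suc k)) = (\<Sum>k<n. a k)"
    using sum.lessThan_Suc_shift[of a n] sum.lessThan_Suc[of a n] assms(3) by simp
  moreover have "F n = F 0" by (simp add: F_def assms)
  ultimately show ?thesis using P Fnz[of 0] assms(4) by simp
qed

lemma lattice_int_combos:
  assumes "is_lattice b L"
  shows lattice_zero: "0 \<in> L"
    and lattice_add: "x \<in> L \<Longrightarrow> y \<in> L \<Longrightarrow> x + y \<in> L"
    and lattice_minus: "x \<in> L \<Longrightarrow> - x \<in> L"
proof -
  obtain B where L: "L = {\<Sum>v\<in>B. of_int (c v) *\<^sub>R v | c :: 'a \<Rightarrow> int. True}"
    using assms unfolding is_lattice_def by blast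
  show "0 \<in> L" unfolding L by (intro CollectI exI[of _ "\<lambda>_. 0"]) simp
  show "x + y \<in> L" if "x \<in> L" "y \<in> L"
  proof -
    obtain c d :: "'a \<Rightarrow> int" where "x = (\<Sum>v\<in>B. of_int (c v) *\<^sub>R v)" "y = (\<Sum>v\<in>B. of_int (d v) *\<^sub>R v)"
      using \<open>x \<in> L\<close> \<open>y \<in> L\<close> unfolding L by blast
    then have "x + y = (\<Sum>v\<in>B. of_int (c v + d v) *\<^sub>R v)"
      by (simp add: sum.distrib scaleR_add_left)
    then show ?thesis unfolding L by (intro CollectI exI[of _ "\<lambda>v. c v + d v"]) simp
  qed
  show "- x \<in> L" if "x \<in> L"
  proof -
    obtain c :: "'a \<Rightarrow> int" where "x = (\<Sum>v\<in>B. of_int (c v) *\<^sub>R v)"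
      using \<open>x \<in> L\<close> unfolding L by blast
    then have "- x = (\<Sum>v\<in>B. of_int (- c v) *\<^sub>R v)"
      by (simp add: sum_negf)
    then show ?thesis unfolding L by (intro CollectI exI[of _ "\<lambda>v. - c v"]) simp
  qed
qed

context
  fixes b :: "'v::real_vector \<Rightarrow> 'v \<Rightarrow> real" and L :: "'v set" and g :: "'v \<Rightarrow> 'v"
    and n :: nat and \<xi> :: complex
  assumes ev: "even_lattice b L" and aut: "lattice_aut b L g" and gn: "has_order g n"
    and root: "primitive_root_of_unity n \<xi>"
begin

private lemma lat: "is_lattice b L" using ev by (simp add: even_lattice_def)
private lemma lin2: "linear (b x)" using lat by (simp add: is_lattice_def)
private lemma sym: "b x y = b y x" using lat by (simp add: is_lattice_def)
private lemma ling: "linear g" using aut by (simp add: lattice_aut_def)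
private lemma int: "x \<in> L \<Longrightarrow> y \<in> L \<Longrightarrow> b x y \<in> \<int>" using ev by (simp add: even_lattice_def)
private lemma gL: "x \<in> L \<Longrightarrow> g x \<in> L" using aut by (auto simp: lattice_aut_def)
private lemma gkL: "x \<in> L \<Longrightarrow> (g ^^ k) x \<in> L" by (induction k) (auto simp: gL)
private lemma lingk: "linear (g ^^ k)"
proof (induction k)
  case 0
  then show ?case by (intro linearI) simp_all
next
  case (Suc k)
  then show ?case unfolding funpow.simps by (intro linear_compose ling)
qed
private lemma gkb: "b ((g ^^ k) x) ((g ^^ k) y) = b x y"
  using aut by (induction k) (auto simp: lattice_aut_def)
private lemma n0: "0 < n" and gnid: "g ^^ n = id" using gn by (auto simp: has_order_def)
private lemma root1: "\<xi> ^ n = 1" using root by (simp add: primitive_root_of_unity_def)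
private lemma b_add2: "b x (y + z) = b x y + b x z" by (rule linear_add[OF lin2])
private lemma b_diff2: "b x (y - z) = b x y - b x z" by (rule linear_diff[OF lin2])
private lemma b_sum2: "b x (\<Sum>i\<in>I. f i) = (\<Sum>i\<in>I. b x (f i))" by (rule linear_sum[OF lin2])
private lemma b_add1: "b (x + y) z = b x z + b y z" using b_add2 sym by metis
private lemma b_diff1: "b (x - y) z = b x z - b y z" using b_diff2 sym by metis

private lemma orbit_sum_fixed: "g (\<Sum>k<n. (g ^^ k) x) = (\<Sum>k<n. (g ^^ k) x)"
proof -
  have "g (\<Sum>k<n. (g ^^ k) x) = (\<Sum>k<n. (g ^^ Suc k) x)" by (simp add: linear_sum[OF ling])
  also have "\<dots> = (\<Sum>k<n. (g ^^ k) x)"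
    using sum.lessThan_Suc_shift[of "\<lambda>k. (g ^^ k) x" n] sum.lessThan_Suc[of "\<lambda>k. (g ^^ k) x" n] gnid
    by (simp add: add.commute)
  finally show ?thesis .
qed

private lemma orbit_sum1:
  assumes "\<beta> \<in> coinvariant_lattice b L g"
  shows "(\<Sum>k<n. b ((g ^^ k) x) \<beta>) = 0"
proof -
  have "(\<Sum>k<n. b ((g ^^ k) x) \<beta>) = b \<beta> (\<Sum>k<n. (g ^^ k) x)"
    by (simp add: b_sum2 sym[of \<beta>])
  then show ?thesis using assms orbit_sum_fixed by (simp add: coinvariant_lattice_def)
qed

private lemma orbit_sum2:
  assumes "\<alpha> \<in> coinvariant_lattice b L g"
  shows "(\<Sum>k<n. b ((g ^^ k) \<alpha>) x) = 0"
proof -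
  let ?f = "\<lambda>k. b \<alpha> ((g ^^ k) x)"
  have "b ((g ^^ k) \<alpha>) x = ?f (n - k)" if "k < n" for k
  proof -
    have "(g ^^ (n - k)) ((g ^^ k) \<alpha>) = (g ^^ (n - k + k)) \<alpha>" by (simp only: funpow_add comp_apply)
    then have "(g ^^ (n - k)) ((g ^^ k) \<alpha>) = \<alpha>" using that gnid by simp
    then show ?thesis using gkb[of "n - k" "(g ^^ k) \<alpha>" x] by simp
  qed
  then have "(\<Sum>k<n. b ((g ^^ k) \<alpha>) x) = (\<Sum>k<n. ?f (n - k))" by simp
  also have "\<dots> = (\<Sum>k<n. ?f (Suc k))"
    by (rule sum.reindex_bij_witness[of _ "\<lambda>k. n - Suc k" "\<lambda>k. n - Suc k"])
       (auto simp: Suc_diff_Suc simp del: funpow.simps)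
  also have "\<dots> = (\<Sum>k<n. ?f k)"
    using sum.lessThan_Suc_shift[of ?f n] sum.lessThan_Suc[of ?f n] gnid by simp
  also have "\<dots> = 0" using orbit_sum1[OF assms, of x] by (simp add: sym[of \<alpha>])
  finally show ?thesis .
qed

private lemma C_telescope:
  assumes e: "\<And>k. b ((g ^^ k) \<alpha>) \<beta> = a k - a (Suc k)"
    and a: "\<And>k. a k \<in> \<int>" "a n = a 0" "(\<Sum>k<n. a k) = (0 :: real)"
  shows "C_lattice b g n \<xi> \<alpha> \<beta> = 1"
proof -
  define a' where "a' k = \<lfloor>a k\<rfloor>" for k
  have aa: "a k = of_int (a' k)" for k using a(1)[of k] by (simp add: a'_def)
  have "\<lfloor>b ((g ^^ k) \<alpha>) \<beta>\<rfloor> = a' k - a' (Suc k)" for k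
    unfolding e aa of_int_diff[symmetric] floor_of_int ..
  moreover have "(\<Sum>k<n. a' k) = 0"
    using a(3) unfolding aa of_int_sum[symmetric] by (simp only: of_int_eq_0_iff)
  moreover have "a' n = a' 0" using a(2) by (simp add: a'_def)
  ultimately show ?thesis
    using telescoping_powi_prod[OF n0 root1, of a'] by (simp add: C_lattice_def)
qed

private lemma C_trivial1:
  assumes "\<gamma> \<in> L" "\<beta> \<in> coinvariant_lattice b L g"
  shows "C_lattice b g n \<xi> (\<gamma> - g \<gamma>) \<beta> = 1"
proof (rule C_telescope[where a = "\<lambda>k. b ((g ^^ k) \<gamma>) \<beta>"])
  show "b ((g ^^ k) (\<gamma> - g \<gamma>)) \<beta> = b ((g ^^ k) \<gamma>) \<beta> - b ((g ^^ Suc k) \<gamma>) \<beta>" for k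
    by (simp add: linear_diff[OF lingk] b_diff1 funpow_swap1)
qed (use assms orbit_sum1 gnid in \<open>auto simp: coinvariant_lattice_def intro: int gkL\<close>)

private lemma C_trivial2:
  assumes "\<gamma> \<in> L" "\<alpha> \<in> coinvariant_lattice b L g"
  shows "C_lattice b g n \<xi> \<alpha> (\<gamma> - g \<gamma>) = 1"
proof (rule C_telescope[where a = "\<lambda>k. - b ((g ^^ k) \<alpha>) (g \<gamma>)"])
  show "b ((g ^^ k) \<alpha>) (\<gamma> - g \<gamma>) = - b ((g ^^ k) \<alpha>) (g \<gamma>) - - b ((g ^^ Suc k) \<alpha>) (g \<gamma>)" for k
    using gkb[of 1 "(g ^^ k) \<alpha>" \<gamma>] by (simp add: b_diff2)
  show "(\<Sum>k<n. - b ((g ^^ k) \<alpha>) (g \<gamma>)) = 0"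
    using orbit_sum2[OF assms(2), of "g \<gamma>"] by (simp add: sum_negf)
qed (use assms gnid in \<open>auto simp: coinvariant_lattice_def intro: int gkL gL\<close>)

private lemma xk: "- (\<xi> ^ k) \<noteq> 0" using root1 n0 by (auto simp: power_0_left)

private lemma C_mult:
  assumes "\<And>k. \<lfloor>b ((g ^^ k) \<alpha>) \<beta>\<rfloor> = \<lfloor>b ((g ^^ k) \<alpha>1) \<beta>1\<rfloor> + \<lfloor>b ((g ^^ k) \<alpha>2) \<beta>2\<rfloor>"
  shows "C_lattice b g n \<xi> \<alpha> \<beta> = C_lattice b g n \<xi> \<alpha>1 \<beta>1 * C_lattice b g n \<xi> \<alpha>2 \<beta>2"
  unfolding C_lattice_def prod.distrib[symmetric] assms minus_add_distrib
  by (intro prod.cong refl power_int_add disjI1 xk)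

private lemma floor_add_Ints: "x \<in> \<int> \<Longrightarrow> \<lfloor>x + y\<rfloor> = \<lfloor>x\<rfloor> + \<lfloor>y :: real\<rfloor>"
  by (auto elim!: Ints_cases)

private lemma C_add1:
  assumes "\<alpha> \<in> L" "\<alpha>' \<in> L" "\<beta> \<in> L"
  shows "C_lattice b g n \<xi> (\<alpha> + \<alpha>') \<beta> = C_lattice b g n \<xi> \<alpha> \<beta> * C_lattice b g n \<xi> \<alpha>' \<beta>"
  by (intro C_mult) (simp add: linear_add[OF lingk] b_add1 floor_add_Ints int gkL assms)

private lemma C_add2:
  assumes "\<alpha> \<in> L" "\<beta> \<in> L" "\<beta>' \<in> L"
  shows "C_lattice b g n \<xi> \<alpha> (\<beta> + \<beta>') = C_lattice b g n \<xi> \<alpha> \<beta> * C_lattice b g n \<xi> \<alpha> \<beta>'"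
  by (intro C_mult) (simp add: b_add2 floor_add_Ints int gkL assms)

private lemma diff_L: "\<gamma> \<in> L \<Longrightarrow> \<gamma> - g \<gamma> \<in> L"
  using lattice_add[OF lat, of \<gamma> "- g \<gamma>"] lattice_minus[OF lat] gL by simp

private lemma diff_coinvariant: "\<gamma> \<in> L \<Longrightarrow> \<gamma> - g \<gamma> \<in> coinvariant_lattice b L g"
  using gkb[of 1 \<gamma>] diff_L by (auto simp: coinvariant_lattice_def b_diff1) (metis diff_self)

private lemma coset_eq:
  "r_coset (add_group M) ((\<lambda>\<alpha>. \<alpha> - g \<alpha>) ` L) \<alpha> = {\<gamma> - g \<gamma> + \<alpha> | \<gamma>. \<gamma> \<in> L}"
  by (auto simp: r_coset_def add_group_def)

lemma C_form_coset:
  defines "K \<equiv> coinvariant_lattice b L g" and "H \<equiv> (\<lambda>\<alpha>. \<alpha> - g \<alpha>) ` L"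
  assumes \<alpha>: "\<alpha> \<in> K" and \<beta>: "\<beta> \<in> K"
  shows "C_form b g n \<xi> (H #>\<^bsub>add_group K\<^esub> \<alpha>) (H #>\<^bsub>add_group K\<^esub> \<beta>) = C_lattice b g n \<xi> \<alpha> \<beta>"
proof -
  have KL: "K \<subseteq> L" by (auto simp: K_def coinvariant_lattice_def)
  have eq: "C_lattice b g n \<xi> (\<gamma> - g \<gamma> + \<alpha>) (\<delta> - g \<delta> + \<beta>) = C_lattice b g n \<xi> \<alpha> \<beta>"
    if "\<gamma> \<in> L" "\<delta> \<in> L" for \<gamma> \<delta>
  proof -
    have "\<alpha> \<in> L" "\<beta> \<in> L" "\<gamma> - g \<gamma> \<in> L" "\<delta> - g \<delta> \<in> L" using that \<alpha> \<beta> KL diff_L by auto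
    then show ?thesis
      using that \<alpha> \<beta> C_trivial1[OF _ diff_coinvariant, of \<gamma> \<delta>] C_trivial1[of \<gamma> \<beta>] C_trivial2[of \<delta> \<alpha>]
      by (simp add: C_add1 C_add2 lattice_add[OF lat] K_def)
  qed
  show ?thesis
    unfolding C_form_def
  proof (rule the_equality)
    show "\<forall>\<alpha>'\<in>H #>\<^bsub>add_group K\<^esub> \<alpha>. \<forall>\<beta>'\<in>H #>\<^bsub>add_group K\<^esub> \<beta>.
            C_lattice b g n \<xi> \<alpha>' \<beta>' = C_lattice b g n \<xi> \<alpha> \<beta>"
      unfolding H_def coset_eq using eq by auto
    fix z
    assume z: "\<forall>\<alpha>'\<in>H #>\<^bsub>add_group K\<^esub> \<alpha>. \<forall>\<beta>'\<in>H #>\<^bsub>add_group K\<^esub> \<beta>. C_lattice b g n \<xi> \<alpha>' \<beta>' = z"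
    have "\<delta> \<in> H #>\<^bsub>add_group K\<^esub> \<delta>" for \<delta>
      unfolding H_def coset_eq using lattice_zero[OF lat] linear_0[OF ling]
      by (intro CollectI exI[of _ 0]) simp
    with z show "z = C_lattice b g n \<xi> \<alpha> \<beta>" by metis
  qed
qed

end

end

theory Submission
  imports Defs "HOL-Algebra.Multiplicative_Group"
begin

text \<open>
  The operators \<open>\<rho> (x, 1)\<close> act on the basis vectors by distinct characters of \<open>A\<close>, so a nonzero
  vector of minimal support in an invariant subspace is a multiple of a basis vector, and the
  operators \<open>\<rho> (1, \<chi>)\<close> move it to all others: \<open>\<rho>\<close> is irreducible.

  Since \<open>L\<^sub>g\<^sup>\<bottom>\<close> is primitive and \<open>n L\<^sub>g\<^sup>\<bottom> \<subseteq> L(1 - g)\<close>, the group \<open>N\<close> is finite.  In any irreducible \<open>\<sigma>\<close>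
  with skew \<open>C\<close>, the operators coming from an isotropic subgroup of \<open>N\<close> therefore commute and have
  finite order up to scalars, so they have a joint eigenvector.  For the subgroup of characters its
  eigenvalues \<open>\<kappa> \<chi>\<close> turn \<open>\<sigma> (1, \<chi>) / \<kappa> \<chi>\<close> into an honest representation; applying it to a joint
  eigenvector of \<open>A\<close> gives vectors that satisfy the relations of the \<open>e\<^sub>\<chi>\<close> up to scalars, and the
  resulting intertwiner is bijective by Schur's lemma.
\<close>

subsection \<open>Character groups\<close>

lemma char_closed: "\<chi> \<in> carrier (char_group G) \<Longrightarrow> x \<in> carrier G \<Longrightarrow> \<chi> x \<noteq> 0"
  by (auto simp: char_group_def hom_def complex_units_def)

lemma char_mult:
  "\<chi> \<in> carrier (char_group G) \<Longrightarrow> x \<in> carrier G \<Longrightarrow> y \<in> carrier G \<Longrightarrow> \<chi> (x \<otimes>\<^bsub>G\<^esub> y) = \<chi> x * \<chi> y"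
  by (auto simp: char_group_def hom_def complex_units_def)

lemma char_group_mult_apply: "x \<in> carrier G \<Longrightarrow> (\<chi> \<otimes>\<^bsub>char_group G\<^esub> \<psi>) x = \<chi> x * \<psi> x"
  by (simp add: char_group_def)

lemma char_group_one_apply: "x \<in> carrier G \<Longrightarrow> \<one>\<^bsub>char_group G\<^esub> x = 1"
  by (simp add: char_group_def)

lemma char_one:
  assumes "group G" "\<chi> \<in> carrier (char_group G)"
  shows "\<chi> \<one>\<^bsub>G\<^esub> = 1"
proof -
  interpret group G by fact
  show ?thesis using char_mult[OF assms(2), of "\<one>\<^bsub>G\<^esub>" "\<one>\<^bsub>G\<^esub>"] char_closed[OF assms(2), of "\<one>\<^bsub>G\<^esub>"] by simp
qed

text \<open>Characters are \<open>undefined\<close> off the carrier, so their values on the carrier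
  determine them as functions.\<close>

lemma char_eqI:
  assumes "\<chi> \<in> carrier (char_group G)" "\<psi> \<in> carrier (char_group G)"
    and "\<And>x. x \<in> carrier G \<Longrightarrow> \<chi> x = \<psi> x"
  shows "\<chi> = \<psi>"
  using assms by (auto simp: char_group_def intro: extensionalityI)

lemma comm_group_char_group:
  assumes "group G"
  shows "comm_group (char_group G)"
proof -
  interpret group G by fact
  show ?thesis
  proof (rule comm_groupI)
    fix \<chi> assume \<chi>: "\<chi> \<in> carrier (char_group G)"
    show "\<exists>\<psi>\<in>carrier (char_group G). \<psi> \<otimes>\<^bsub>char_group G\<^esub> \<chi> = \<one>\<^bsub>char_group G\<^esub>"
    proof
      show "(\<lambda>x\<in>carrier G. inverse (\<chi> x)) \<in> carrier (char_group G)"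
        using \<chi> by (auto simp: char_group_def hom_def complex_units_def)
      show "(\<lambda>x\<in>carrier G. inverse (\<chi> x)) \<otimes>\<^bsub>char_group G\<^esub> \<chi> = \<one>\<^bsub>char_group G\<^esub>"
        using char_closed[OF \<chi>] by (auto simp: char_group_def)
    qed
  qed (auto simp: char_group_def hom_def complex_units_def restrict_def extensional_def fun_eq_iff)
qed

subsection \<open>Linear maps and free vector spaces\<close>

text \<open>The weakening of \<open>clinear_iso\<close> for maps whose bijectivity is still to be
  shown. Values off \<open>W\<close> are left free, because a vector space is only a subset of its
  type.\<close>

definition clinear_on ::
    "(complex \<Rightarrow> 'w::ab_group_add \<Rightarrow> 'w) \<Rightarrow> 'w set \<Rightarrow>
     (complex \<Rightarrow> 'u::ab_group_add \<Rightarrow> 'u) \<Rightarrow> 'u set \<Rightarrow> ('w \<Rightarrow> 'u) \<Rightarrow> bool" where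
  "clinear_on s W s' W' T \<longleftrightarrow>
     T ` W \<subseteq> W' \<and> (\<forall>v\<in>W. \<forall>w\<in>W. T (v + w) = T v + T w) \<and> (\<forall>a. \<forall>w\<in>W. T (s a w) = s' a (T w))"

lemma clinear_iso_iff: "clinear_iso s W s' W' T \<longleftrightarrow> clinear_on s W s' W' T \<and> bij_betw T W W'"
  by (auto simp: clinear_iso_def clinear_on_def bij_betw_def)

lemma clinear_onD:
  assumes "clinear_on s W s' W' T"
  shows "w \<in> W \<Longrightarrow> T w \<in> W'" "v \<in> W \<Longrightarrow> w \<in> W \<Longrightarrow> T (v + w) = T v + T w"
    "w \<in> W \<Longrightarrow> T (s a w) = s' a (T w)"
  using assms by (auto simp: clinear_on_def)

lemma clinear_on_zero:
  assumes "clinear_on s W s' W' T" "cvector_space s W"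
  shows "T 0 = 0"
proof -
  interpret vector_space s using assms(2) by (simp add: cvector_space_def)
  have "0 \<in> W" using assms(2) by (simp add: cvector_space_def subspace_0)
  then show ?thesis using clinear_onD(2)[OF assms(1), of 0 0] by simp
qed

text \<open>The index set is arbitrary: over an infinite one both sums are 0, and
  \<open>T 0 = 0\<close>.\<close>

lemma clinear_on_sum:
  assumes "clinear_on s W s' W' T" "cvector_space s W" "\<And>i. i \<in> I \<Longrightarrow> f i \<in> W"
  shows "T (\<Sum>i\<in>I. f i) = (\<Sum>i\<in>I. T (f i))"
proof -
  interpret vector_space s using assms(2) by (simp add: cvector_space_def)
  have W: "subspace W" using assms(2) by (simp add: cvector_space_def)
  show ?thesis
    using assms(3)
    by (induction I rule: infinite_finite_induct)
      (simp_all add: clinear_on_zero[OF assms(1,2)] clinear_onD(2)[OF assms(1)] subspace_sum[OF W])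
qed

section \<open>Free vector spaces and their universal property\<close>

lemma subspace_free_space: "module.subspace fun_scale (free_space X)"
proof -
  interpret vector_space fun_scale by (rule vector_space_fun_scale)
  show ?thesis by (simp add: free_space_eq_span)
qed

lemma cvector_space_free_space: "cvector_space fun_scale (free_space X)"
  by (simp add: cvector_space_def vector_space_fun_scale subspace_free_space)

lemma basis_vec_in_free_space: "i \<in> X \<Longrightarrow> basis_vec i \<in> free_space X"
  by (simp add: free_space_def basis_vec_def)

lemma free_space_induct [consumes 1, case_names zero step]:
  assumes f: "f \<in> free_space X" and 0: "P 0"
    and step: "\<And>a i h. i \<in> X \<Longrightarrow> h \<in> free_space X \<Longrightarrow> P h \<Longrightarrow> P (fun_scale a (basis_vec i) + h)"
  shows "P f"
proof -
  interpret vector_space fun_scale by (rule vector_space_fun_scale)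
  \<comment> \<open>Membership in the span is carried through the induction, since the hypothesis
    \<open>step\<close> asks for it on the tail \<open>h\<close>.\<close>
  have "f \<in> span (basis_vec ` X) \<and> P f"
    using f unfolding free_space_eq_span
  proof (induction rule: span_induct_alt)
    case base
    show ?case using span_zero 0 by blast
  next
    case (step a v h)
    then obtain i where "i \<in> X" "v = basis_vec i" by blast
    with step assms(3)[unfolded free_space_eq_span] show ?case
      by (blast intro: span_add span_scale span_base)
  qed
  then show ?thesis ..
qed

text \<open>The codomains \<open>W'\<close> and \<open>W''\<close> may differ, which allows
  comparison with an explicit formula whose range is only known to lie in
  \<open>UNIV\<close>.\<close>

lemma clinear_on_free_space_eqI:
  assumes T: "clinear_on fun_scale (free_space X) s' W' T"
    and T': "clinear_on fun_scale (free_space X) s' W'' T'"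
    and "\<And>i. i \<in> X \<Longrightarrow> T (basis_vec i) = T' (basis_vec i)" and "f \<in> free_space X"
  shows "T f = T' f"
proof -
  interpret vector_space fun_scale by (rule vector_space_fun_scale)
  show ?thesis
    using assms(4)
  proof (induction rule: free_space_induct)
    case zero
    show ?case
      by (simp only: clinear_on_zero[OF T cvector_space_free_space]
          clinear_on_zero[OF T' cvector_space_free_space])
  next
    case (step a i h)
    have "fun_scale a (basis_vec i) \<in> free_space X"
      by (intro subspace_scale[OF subspace_free_space] basis_vec_in_free_space step)
    with step assms(3) show ?case
      by (simp only: clinear_onD(2,3)[OF T] clinear_onD(2,3)[OF T'] basis_vec_in_free_space)
  qed
qed

text \<open>The universal property of the free space: the linear map with prescribed images of the
  basis. It generalises \<open>linear_extension\<close> to an arbitrary target space, as needed for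
  the intertwiner.\<close>

definition free_lift ::
    "(complex \<Rightarrow> 'w::ab_group_add \<Rightarrow> 'w) \<Rightarrow> ('i \<Rightarrow> 'w) \<Rightarrow> ('i \<Rightarrow> complex) \<Rightarrow> 'w" where
  "free_lift s v f = (\<Sum>i | f i \<noteq> 0. s (f i) (v i))"

lemma linear_extension_eq: "linear_extension v = free_lift fun_scale v"
  by (simp add: fun_eq_iff linear_extension_def free_lift_def)

lemma free_lift_basis_vec:
  assumes "vector_space s"
  shows "free_lift s v (basis_vec i) = v i"
proof -
  interpret vector_space s by fact
  have "{j. basis_vec i j \<noteq> 0} = {i}" by (auto simp: basis_vec_def)
  then show ?thesis by (simp add: free_lift_def basis_vec_def)
qed

lemma clinear_on_free_lift:
  assumes "cvector_space s W" and v: "\<And>i. i \<in> X \<Longrightarrow> v i \<in> W"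
  shows "clinear_on fun_scale (free_space X) s W (free_lift s v)"
proof -
  interpret vector_space s using assms(1) by (simp add: cvector_space_def)
  have W: "subspace W" using assms(1) by (simp add: cvector_space_def)
  \<comment> \<open>Any finite set containing the support may index the sum. This handles
    cancellation in \<open>f + h\<close> and the scalar 0, where supports shrink.\<close>
  have super: "free_lift s v f = (\<Sum>i\<in>S. s (f i) (v i))" if "finite S" "{i. f i \<noteq> 0} \<subseteq> S" for f S
    unfolding free_lift_def using that by (intro sum.mono_neutral_left) auto
  show ?thesis
    unfolding clinear_on_def
  proof (intro conjI ballI allI)
    show "free_lift s v ` free_space X \<subseteq> W"
      by (auto simp: free_lift_def free_space_def intro!: subspace_sum[OF W] subspace_scale[OF W] v)
    fix f h assume "f \<in> free_space X" "h \<in> free_space X"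
    then have fin: "finite ({i. f i \<noteq> 0} \<union> {i. h i \<noteq> 0})" by (simp add: free_space_def)
    show "free_lift s v (f + h) = free_lift s v f + free_lift s v h"
      by (subst (1 2 3) super[OF fin])
        (auto simp: sum.distrib scale_left_distrib)
  next
    fix a f assume "f \<in> free_space X"
    then have fin: "finite {i. f i \<noteq> 0}" by (simp add: free_space_def)
    show "free_lift s v (fun_scale a f) = s a (free_lift s v f)"
      by (subst (1 2) super[OF fin]) (auto simp: scale_sum_right fun_scale_def)
  qed
qed

lemma clinear_on_compose:
  assumes "clinear_on s W s' W' T" "clinear_on s' W' s'' W'' T'"
  shows "clinear_on s W s'' W'' (\<lambda>w. T' (T w))"
  using assms by (auto simp: clinear_on_def image_subset_iff)

lemma clinear_on_scale:
  assumes "clinear_on s W s' W' T" "cvector_space s' W'"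
  shows "clinear_on s W s' W' (\<lambda>w. s' a (T w))"
proof -
  interpret vector_space s' using assms(2) by (simp add: cvector_space_def)
  have "subspace W'" using assms(2) by (simp add: cvector_space_def)
  then show ?thesis using assms(1)
    by (auto simp: clinear_on_def image_subset_iff subspace_scale scale_right_distrib mult.commute)
qed

subsection \<open>The model representation\<close>

context
  fixes G :: "('a, 'm) monoid_scheme"
  assumes G: "group G"
begin

interpretation G: group G by (rule G)
interpretation D: comm_group "char_group G" by (rule comm_group_char_group[OF G])

lemma clinear_on_rho0:
  assumes "x \<in> carrier G" "\<chi> \<in> carrier (char_group G)"
  shows "clinear_on fun_scale (Omega0 G) fun_scale (Omega0 G) (rho0 G (x, \<chi>))"
proof -
  interpret vector_space fun_scale by (rule vector_space_fun_scale)
  show ?thesis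
    unfolding rho0_def linear_extension_eq Omega0_def prod.case
    by (intro clinear_on_free_lift cvector_space_free_space subspace_scale[OF subspace_free_space]
        basis_vec_in_free_space D.m_closed assms)
qed

lemma clinear_on_Omega0_eqI:
  assumes "clinear_on fun_scale (Omega0 G) s' W' T" "clinear_on fun_scale (Omega0 G) s' W'' T'"
    and "\<And>\<chi>. \<chi> \<in> carrier (char_group G) \<Longrightarrow> T (basis_vec \<chi>) = T' (basis_vec \<chi>)" and "f \<in> Omega0 G"
  shows "T f = T' f"
  using assms unfolding Omega0_def by (rule clinear_on_free_space_eqI)

lemma cvector_space_Omega0: "cvector_space fun_scale (Omega0 G)"
  by (simp add: Omega0_def cvector_space_free_space)

lemma basis_vec_in_Omega0: "\<chi> \<in> carrier (char_group G) \<Longrightarrow> basis_vec \<chi> \<in> Omega0 G"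
  by (simp add: Omega0_def basis_vec_in_free_space)

text \<open>On \<open>basis_vec \<phi>\<close> the left side picks up \<phi>(y) and then
  (\<psi>\<phi>)(x) = \<psi>(x)\<phi>(x). The product \<phi>(x)\<phi>(y) = \<phi>(xy) belongs to the
  operator on the right, so \<psi>(x) is left over as the cocycle.\<close>

lemma rho0_mult:
  assumes "x \<in> carrier G" "\<chi> \<in> carrier (char_group G)" "y \<in> carrier G" "\<psi> \<in> carrier (char_group G)"
    and "f \<in> Omega0 G"
  shows "rho0 G (x, \<chi>) (rho0 G (y, \<psi>) f)
    = fun_scale (\<psi> x) (rho0 G (x \<otimes>\<^bsub>G\<^esub> y, \<chi> \<otimes>\<^bsub>char_group G\<^esub> \<psi>) f)"
proof -
  let ?T = "\<lambda>f. rho0 G (x, \<chi>) (rho0 G (y, \<psi>) f)"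
  let ?T' = "\<lambda>f. fun_scale (\<psi> x) (rho0 G (x \<otimes>\<^bsub>G\<^esub> y, \<chi> \<otimes>\<^bsub>char_group G\<^esub> \<psi>) f)"
  have T: "clinear_on fun_scale (Omega0 G) fun_scale (Omega0 G) ?T"
    by (rule clinear_on_compose[OF clinear_on_rho0 clinear_on_rho0]) fact+
  have T': "clinear_on fun_scale (Omega0 G) fun_scale (Omega0 G) ?T'"
    by (intro clinear_on_scale clinear_on_rho0 cvector_space_Omega0 G.m_closed D.m_closed assms)
  have "?T (basis_vec \<phi>) = ?T' (basis_vec \<phi>)" if \<phi>: "\<phi> \<in> carrier (char_group G)" for \<phi>
    using assms \<phi>
    by (simp add: rho0_basis_vec clinear_onD(3)[OF clinear_on_rho0] basis_vec_in_Omega0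
        char_group_mult_apply char_mult D.m_assoc)
      (simp add: fun_scale_def mult_ac)
  from clinear_on_Omega0_eqI[OF T T' this assms(5)] show ?thesis .
qed

lemma rho0_one:
  assumes "f \<in> Omega0 G"
  shows "rho0 G (\<one>\<^bsub>G\<^esub>, \<one>\<^bsub>char_group G\<^esub>) f = f"
proof (rule clinear_on_Omega0_eqI[where T' = "\<lambda>f. f"])
  show "clinear_on fun_scale (Omega0 G) fun_scale (Omega0 G) (\<lambda>f. f)"
    by (simp add: clinear_on_def)
next
  fix \<phi> assume "\<phi> \<in> carrier (char_group G)"
  then show "rho0 G (\<one>\<^bsub>G\<^esub>, \<one>\<^bsub>char_group G\<^esub>) (basis_vec \<phi>) = basis_vec \<phi>"
    by (simp add: rho0_basis_vec char_one[OF G] fun_scale_def)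
qed (use assms clinear_on_rho0 in auto)

text \<open>The coordinate form of the diagonal operators, used to separate distinct characters in
  the support of a vector.\<close>

lemma rho0_apply:
  assumes "x \<in> carrier G" "f \<in> Omega0 G"
  shows "rho0 G (x, \<one>\<^bsub>char_group G\<^esub>) f = (\<lambda>\<psi>. \<psi> x * f \<psi>)"
proof (rule clinear_on_Omega0_eqI[where T' = "\<lambda>f \<psi>. \<psi> x * f \<psi>"])
  \<comment> \<open>With target \<open>UNIV\<close>, finiteness of the support of the pointwise
    product need not be shown.\<close>
  show "clinear_on fun_scale (Omega0 G) fun_scale UNIV (\<lambda>f \<psi>. \<psi> x * f \<psi>)"
    by (auto simp: clinear_on_def fun_eq_iff fun_scale_def algebra_simps)
next
  fix \<phi> assume "\<phi> \<in> carrier (char_group G)"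
  then show "rho0 G (x, \<one>\<^bsub>char_group G\<^esub>) (basis_vec \<phi>) = (\<lambda>\<psi>. \<psi> x * basis_vec \<phi> \<psi>)"
    by (simp only: rho0_basis_vec D.l_one) (auto simp: fun_scale_def basis_vec_def)
qed (use assms clinear_on_rho0 in auto)

lemma rho0_irreducible:
  assumes U: "module.subspace fun_scale U" "U \<subseteq> Omega0 G"
    and inv: "\<And>x \<chi>. x \<in> carrier G \<Longrightarrow> \<chi> \<in> carrier (char_group G) \<Longrightarrow> rho0 G (x, \<chi>) ` U \<subseteq> U"
  shows "U = {0} \<or> U = Omega0 G"
proof (rule disj_imp[THEN iffD2], rule impI)
  interpret vector_space fun_scale by (rule vector_space_fun_scale)
  let ?supp = "\<lambda>f :: ('a \<Rightarrow> complex) \<Rightarrow> complex. {\<psi>. f \<psi> \<noteq> 0}"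
  assume "U \<noteq> {0}"
  then have "\<exists>f. f \<in> U \<and> f \<noteq> 0" using subspace_0[OF U(1)] by blast
  \<comment> \<open>The support size \<open>card\<close> is a faithful measure here, since every
    element of \<open>Omega0 G\<close> has finite support.\<close>
  then obtain f where f: "f \<in> U" "f \<noteq> 0"
    and min: "\<And>h. h \<in> U \<Longrightarrow> h \<noteq> 0 \<Longrightarrow> card (?supp f) \<le> card (?supp h)"
    using ex_has_least_nat[of "\<lambda>f. f \<in> U \<and> f \<noteq> 0" _ "\<lambda>f. card (?supp f)"] by metis
  have fin: "finite (?supp f)" and sub: "?supp f \<subseteq> carrier (char_group G)"
    using f(1) U(2) by (auto simp: Omega0_def free_space_def)
  from f(2) obtain \<psi> where \<psi>: "f \<psi> \<noteq> 0" by (auto simp: fun_eq_iff)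
  have only: "\<phi> = \<psi>" if \<phi>: "f \<phi> \<noteq> 0" for \<phi>
  proof (rule ccontr)
    assume "\<phi> \<noteq> \<psi>"
    then obtain x where x: "x \<in> carrier G" "\<phi> x \<noteq> \<psi> x"
      using char_eqI[of \<phi> G \<psi>] sub \<phi> \<psi> by blast
    \<comment> \<open>The coordinate at \<psi> is annihilated, the one at \<phi> survives because
      \<phi>(x) and \<psi>(x) differ, and no new coordinate appears. So \<open>h\<close> contradicts
      the minimality of \<open>f\<close>.\<close>
    define h where "h = rho0 G (x, \<one>\<^bsub>char_group G\<^esub>) f - fun_scale (\<psi> x) f"
    have h: "h \<chi> = (\<chi> x - \<psi> x) * f \<chi>" for \<chi>
      using rho0_apply[OF x(1)] f(1) U(2) by (auto simp: h_def fun_scale_def algebra_simps)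
    have "h \<in> U" unfolding h_def using inv[OF x(1) D.one_closed] f(1)
      by (intro subspace_diff[OF U(1)] subspace_scale[OF U(1)]) auto
    moreover have "h \<phi> \<noteq> 0" using x(2) \<phi> by (simp add: h)
    then have "h \<noteq> 0" by auto
    moreover have "?supp h \<subset> ?supp f" using \<psi> by (auto simp: h)
    then have "card (?supp h) < card (?supp f)" using fin by (rule psubset_card_mono[rotated])
    ultimately show False using min[of h] by simp
  qed
  have "f = fun_scale (f \<psi>) (basis_vec \<psi>)"
  proof
    fix \<phi>
    show "f \<phi> = fun_scale (f \<psi>) (basis_vec \<psi>) \<phi>"
      using only[of \<phi>] by (cases "\<phi> = \<psi>") (auto simp: fun_scale_def basis_vec_def)
  qed
  then have "fun_scale (inverse (f \<psi>)) f = fun_scale (inverse (f \<psi>)) (fun_scale (f \<psi>) (basis_vec \<psi>))"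
    by (rule arg_cong)
  also have "\<dots> = basis_vec \<psi>"
    using \<psi> by simp
  finally have "fun_scale (inverse (f \<psi>)) f = basis_vec \<psi>" .
  then have e\<psi>: "basis_vec \<psi> \<in> U" using subspace_scale[OF U(1) f(1)] by metis
  have \<psi>c: "\<psi> \<in> carrier (char_group G)" using sub \<psi> by blast
  have "basis_vec \<chi> \<in> U" if \<chi>: "\<chi> \<in> carrier (char_group G)" for \<chi>
  proof -
    \<comment> \<open>The quotient of \<chi> by \<psi> shifts the index from \<psi> to \<chi>, and
      the scalar is \<psi>(1) = 1.\<close>
    have "rho0 G (\<one>\<^bsub>G\<^esub>, \<chi> \<otimes>\<^bsub>char_group G\<^esub> inv\<^bsub>char_group G\<^esub> \<psi>) (basis_vec \<psi>) = basis_vec \<chi>"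
      using \<chi> \<psi>c by (simp add: rho0_basis_vec char_one[OF G] fun_scale_def D.m_assoc)
    then show ?thesis
      using inv[of "\<one>\<^bsub>G\<^esub>" "\<chi> \<otimes>\<^bsub>char_group G\<^esub> inv\<^bsub>char_group G\<^esub> \<psi>"] e\<psi> \<chi> \<psi>c by (metis D.inv_closed
          D.m_closed G.one_closed image_subset_iff)
  qed
  then have "Omega0 G \<subseteq> U"
    unfolding Omega0_def free_space_eq_span by (intro span_minimal U(1)) auto
  with U(2) show "U = Omega0 G" by blast
qed

end

subsection \<open>Projective representations\<close>

text \<open>Multiplication by a primitive \<open>m\<close>-th root of unity \<omega> permutes the
  \<open>m\<close>-th roots of \<open>a\<close>, so the sum equals itself times \<omega>^k, and
  \<omega>^k is not 1 for 0 < k < m.\<close>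

lemma sum_powers_of_roots:
  fixes a :: complex
  assumes "0 < k" "k < m"
  shows "(\<Sum>z | z ^ m = a. z ^ k) = 0"
proof -
  define \<omega> where "\<omega> = cis (2 * pi / real m)"
  have \<omega>: "\<omega> ^ j = cis (2 * pi * real j / real m)" for j
    by (simp add: \<omega>_def DeMoivre mult_ac)
  have "inj_on (\<lambda>j. \<omega> ^ j) {..<m}"
    using bij_betw_roots_unity[of m] assms by (simp add: \<omega> bij_betw_def)
  from inj_onD[OF this, of k 0] have ne: "\<omega> ^ k \<noteq> 1" using assms by auto
  have \<omega>m: "\<omega> ^ m = 1" using \<omega>[of m] assms by simp
  have \<omega>0: "\<omega> \<noteq> 0" by (simp add: \<omega>_def)
  have "(\<Sum>z | z ^ m = a. z ^ k) = (\<Sum>z | z ^ m = a. (\<omega> * z) ^ k)"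
    by (rule sum.reindex_bij_witness[of _ "\<lambda>z. \<omega> * z" "\<lambda>z. z / \<omega>"])
      (use \<omega>0 \<omega>m in \<open>auto simp: power_mult_distrib power_divide\<close>)
  also have "\<dots> = \<omega> ^ k * (\<Sum>z | z ^ m = a. z ^ k)"
    by (simp add: power_mult_distrib sum_distrib_left)
  finally show ?thesis using ne by simp
qed

lemma clinear_on_funpow:
  "clinear_on s W s W T \<Longrightarrow> clinear_on s W s W (T ^^ k)"
  by (induction k) (auto simp: clinear_on_def image_subset_iff)

text \<open>For each root z of z^m = 1/a the sum of the z^k T^k w is fixed by z T. Over all such z
  these sums add up to m w, which is nonzero, so one of them is nonzero. The vector is given
  explicitly so that operators commuting with \<open>T\<close> can be evaluated on it.\<close>

lemma eigenvector_of_finite_order: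
  assumes W: "cvector_space s W" and T: "clinear_on s W s W T" and w: "w \<in> W" "w \<noteq> 0"
    and m: "0 < m" and a: "a \<noteq> 0" "(T ^^ m) w = s a w"
  obtains z where "(\<Sum>k<m. s (z ^ k) ((T ^^ k) w)) \<noteq> 0"
    "T (\<Sum>k<m. s (z ^ k) ((T ^^ k) w)) = s (inverse z) (\<Sum>k<m. s (z ^ k) ((T ^^ k) w))"
proof -
  interpret vector_space s using W by (simp add: cvector_space_def)
  have sub: "subspace W" using W by (simp add: cvector_space_def)
  define v where "v z = (\<Sum>k<m. s (z ^ k) ((T ^^ k) w))" for z
  let ?Z = "{z. z ^ m = inverse a}"
  have Tk: "(T ^^ k) w \<in> W" for k by (rule clinear_onD(1)[OF clinear_on_funpow[OF T] w(1)])
  have "(\<Sum>z\<in>?Z. v z) = (\<Sum>k<m. s (\<Sum>z\<in>?Z. z ^ k) ((T ^^ k) w))"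
    unfolding v_def by (subst sum.swap) (simp add: scale_sum_left)
  \<comment> \<open>Summed over the \<open>m\<close> roots, z^k gives 0 for 0 < k < m and
    \<open>m\<close> for k = 0.\<close>
  also have "\<dots> = (\<Sum>k<m. if k = 0 then s (of_nat m) w else 0)"
    using sum_powers_of_roots[of _ m "inverse a"] card_nth_roots[of "inverse a" m] a(1) m
    by (intro sum.cong) auto
  also have "\<dots> = s (of_nat m) w" using m by simp
  finally have "(\<Sum>z\<in>?Z. v z) \<noteq> 0" using m w(2) by simp
  then obtain z where z: "z ^ m = inverse a" "v z \<noteq> 0" by (metis (mono_tags, lifting) mem_Collect_eq sum.neutral)
  then have z0: "z \<noteq> 0" using a(1) m by (auto simp: power_0_left)
  have "s z (T (v z)) = s z (\<Sum>k<m. T (s (z ^ k) ((T ^^ k) w)))"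
    unfolding v_def by (subst clinear_on_sum[OF T W]) (auto intro: subspace_scale[OF sub] Tk)
  also have "\<dots> = (\<Sum>k<m. s (z ^ Suc k) ((T ^^ Suc k) w))"
    by (simp add: scale_sum_right clinear_onD(3)[OF T Tk])
  \<comment> \<open>The shift loses the term \<open>w\<close> at k = 0 and gains z^m T^m w, which is
    \<open>w\<close> again by the choice of \<open>z\<close>.\<close>
  also have "\<dots> = v z"
    using sum.lessThan_Suc_shift[of "\<lambda>k. s (z ^ k) ((T ^^ k) w)" m]
      sum.lessThan_Suc[of "\<lambda>k. s (z ^ k) ((T ^^ k) w)" m] a z(1)
    by (simp add: v_def)
  finally have "T (v z) = s (inverse z) (v z)" using z0 by (metis left_inverse scale_one scale_scale)
  with z(2) show thesis unfolding v_def by (rule that)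
qed

section \<open>Calculation rules and joint eigenvectors for projective representations of an abelian
  group\<close>

context
  fixes N :: "('n, 'm) monoid_scheme" and c C and s :: "complex \<Rightarrow> 'w::ab_group_add \<Rightarrow> 'w" and W \<sigma>
  assumes N: "comm_group N" and rep: "projective_rep N c s W \<sigma>" and skew: "has_skew N c C"
begin

interpretation N: comm_group N by (rule N)
interpretation vector_space s using rep by (simp add: projective_rep_def cvector_space_def)

lemma projective_rep_cvector_space: "cvector_space s W"
  using rep by (simp add: projective_rep_def)

lemma projective_rep_subspace: "subspace W"
  using rep by (simp add: projective_rep_def cvector_space_def)

lemma projective_rep_cocycle_nonzero: "\<mu> \<in> carrier N \<Longrightarrow> \<nu> \<in> carrier N \<Longrightarrow> c \<mu> \<nu> \<noteq> 0"
  using rep by (simp add: projective_rep_def two_cocycle_def)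

lemma projective_rep_linear: "\<mu> \<in> carrier N \<Longrightarrow> clinear_on s W s W (\<sigma> \<mu>)"
  using rep by (simp add: projective_rep_def clinear_iso_iff)

lemma projective_rep_bij: "\<mu> \<in> carrier N \<Longrightarrow> bij_betw (\<sigma> \<mu>) W W"
  using rep by (simp add: projective_rep_def clinear_iso_iff)

lemma projective_rep_closed: "\<mu> \<in> carrier N \<Longrightarrow> w \<in> W \<Longrightarrow> \<sigma> \<mu> w \<in> W"
  by (rule clinear_onD(1)[OF projective_rep_linear])

lemma projective_rep_scale: "\<mu> \<in> carrier N \<Longrightarrow> w \<in> W \<Longrightarrow> \<sigma> \<mu> (s a w) = s a (\<sigma> \<mu> w)"
  by (rule clinear_onD(3)[OF projective_rep_linear])

lemma projective_rep_nonzero: "\<mu> \<in> carrier N \<Longrightarrow> w \<in> W \<Longrightarrow> w \<noteq> 0 \<Longrightarrow> \<sigma> \<mu> w \<noteq> 0"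
  using projective_rep_bij[of \<mu>] subspace_0[OF projective_rep_subspace]
    clinear_on_zero[OF projective_rep_linear projective_rep_cvector_space, of \<mu>]
  by (metis bij_betw_inv_into_left)

lemma projective_rep_mult:
  "\<mu> \<in> carrier N \<Longrightarrow> \<nu> \<in> carrier N \<Longrightarrow> w \<in> W \<Longrightarrow> \<sigma> \<mu> (\<sigma> \<nu> w) = s (c \<mu> \<nu>) (\<sigma> (\<mu> \<otimes>\<^bsub>N\<^esub> \<nu>) w)"
  using rep by (simp add: projective_rep_def)

text \<open>As \<open>N\<close> is abelian, both products are multiples of the same operator, and
  the ratio of the two factors is the skew.\<close>

lemma projective_rep_commute:
  assumes "\<mu> \<in> carrier N" "\<nu> \<in> carrier N" "w \<in> W"
  shows "\<sigma> \<mu> (\<sigma> \<nu> w) = s (C \<mu> \<nu>) (\<sigma> \<nu> (\<sigma> \<mu> w))"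
proof -
  have "C \<mu> \<nu> * c \<nu> \<mu> = c \<mu> \<nu>"
    using skew[unfolded has_skew_def, rule_format, OF assms(1,2), symmetric]
      projective_rep_cocycle_nonzero[OF assms(2,1)] by simp
  then show ?thesis
    using assms by (simp add: projective_rep_mult N.m_comm[of \<nu> \<mu>])
qed

text \<open>The cocycle is not normalised, so the identity acts by a scalar. Surjectivity allows w =
  \<sigma>(1)v, and then \<sigma>(1)\<sigma>(1)v = c(1,1)\<sigma>(1)v is the claim.\<close>

lemma projective_rep_one:
  assumes "w \<in> W"
  shows "\<sigma> \<one>\<^bsub>N\<^esub> w = s (c \<one>\<^bsub>N\<^esub> \<one>\<^bsub>N\<^esub>) w"
proof -
  have "w \<in> \<sigma> \<one>\<^bsub>N\<^esub> ` W" using projective_rep_bij[of "\<one>\<^bsub>N\<^esub>"] assms by (simp add: bij_betw_def)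
  then obtain v where "v \<in> W" "w = \<sigma> \<one>\<^bsub>N\<^esub> v" by blast
  then show ?thesis using projective_rep_mult[of "\<one>\<^bsub>N\<^esub>" "\<one>\<^bsub>N\<^esub>" v] by simp
qed

text \<open>The scalar accumulates cocycle values and hence does not depend on \<open>w\<close>. It
  starts with the inverse of c(1,1), which undoes the action of the identity.\<close>

lemma projective_rep_funpow:
  assumes \<mu>: "\<mu> \<in> carrier N"
  shows "\<exists>d. d \<noteq> 0 \<and> (\<forall>w\<in>W. (\<sigma> \<mu> ^^ k) w = s d (\<sigma> (\<mu> [^]\<^bsub>N\<^esub> k) w))"
proof (induction k)
  case 0
  have "\<forall>w\<in>W. w = s (inverse (c \<one>\<^bsub>N\<^esub> \<one>\<^bsub>N\<^esub>)) (\<sigma> \<one>\<^bsub>N\<^esub> w)"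
    using projective_rep_cocycle_nonzero[of "\<one>\<^bsub>N\<^esub>" "\<one>\<^bsub>N\<^esub>"] by (simp add: projective_rep_one)
  then show ?case
    using projective_rep_cocycle_nonzero[of "\<one>\<^bsub>N\<^esub>" "\<one>\<^bsub>N\<^esub>"]
    by (intro exI[of _ "inverse (c \<one>\<^bsub>N\<^esub> \<one>\<^bsub>N\<^esub>)"]) simp
next
  case (Suc k)
  then obtain d where d: "d \<noteq> 0" "\<forall>w\<in>W. (\<sigma> \<mu> ^^ k) w = s d (\<sigma> (\<mu> [^]\<^bsub>N\<^esub> k) w)" by blast
  have "\<mu> \<otimes>\<^bsub>N\<^esub> \<mu> [^]\<^bsub>N\<^esub> k = \<mu> [^]\<^bsub>N\<^esub> Suc k" using \<mu> by (simp add: N.m_comm)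
  then show ?case
    using d \<mu> projective_rep_cocycle_nonzero[OF \<mu>, of "\<mu> [^]\<^bsub>N\<^esub> k"]
    by (intro exI[of _ "d * c \<mu> (\<mu> [^]\<^bsub>N\<^esub> k)"])
      (simp add: projective_rep_scale projective_rep_closed projective_rep_mult)
qed

text \<open>Induction on \<open>F\<close>: the new vector is a combination of powers of
  \<open>\<sigma> \<mu>\<close> applied to the old one. Trivial skew makes the operators commute, so
  the old eigenvalues persist.\<close>

lemma joint_eigenvector:
  assumes fin: "finite (carrier N)" and W0: "W \<noteq> {0}" and "F \<subseteq> carrier N"
    and "\<And>\<mu> \<nu>. \<mu> \<in> F \<Longrightarrow> \<nu> \<in> F \<Longrightarrow> C \<mu> \<nu> = 1"
  shows "\<exists>w\<in>W. w \<noteq> 0 \<and> (\<forall>\<mu>\<in>F. \<exists>a. a \<noteq> 0 \<and> \<sigma> \<mu> w = s a w)"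
proof -
  have "finite F" using fin assms(3) by (rule rev_finite_subset)
  then have "\<exists>w\<in>W. w \<noteq> 0 \<and> (\<forall>\<mu>\<in>F. \<exists>a. \<sigma> \<mu> w = s a w)"
    using assms(3,4)
  proof (induction F)
    case empty
    then show ?case using W0 subspace_0[OF projective_rep_subspace] by blast
  next
    case (insert \<mu> F)
    have \<mu>: "\<mu> \<in> carrier N" and F: "F \<subseteq> carrier N" using insert.prems by auto
    obtain w where w: "w \<in> W" "w \<noteq> 0" "\<forall>\<nu>\<in>F. \<exists>a. \<sigma> \<nu> w = s a w"
      using insert.IH[OF F] insert.prems(2) by auto
    let ?T = "\<sigma> \<mu>" and ?m = "order N"
    have m: "0 < ?m" using fin N.one_closed by (auto simp: order_def card_gt_0_iff)
    \<comment> \<open>Since \<mu> to the power \<open>order N\<close> is the identity, this power of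
      \<open>\<sigma> \<mu>\<close> is a scalar.\<close>
    obtain d where d: "d \<noteq> 0" "(?T ^^ ?m) w = s d (\<sigma> \<one>\<^bsub>N\<^esub> w)"
      using projective_rep_funpow[OF \<mu>, of ?m] N.pow_order_eq_1[OF \<mu>] w(1) by auto
    obtain z where z: "(\<Sum>k<?m. s (z ^ k) ((?T ^^ k) w)) \<noteq> 0"
      "?T (\<Sum>k<?m. s (z ^ k) ((?T ^^ k) w)) = s (inverse z) (\<Sum>k<?m. s (z ^ k) ((?T ^^ k) w))"
    proof (rule eigenvector_of_finite_order[OF projective_rep_cvector_space
          projective_rep_linear[OF \<mu>] w(1,2) m])
      show "d * c \<one>\<^bsub>N\<^esub> \<one>\<^bsub>N\<^esub> \<noteq> 0" using d(1) projective_rep_cocycle_nonzero by simp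
      show "(?T ^^ ?m) w = s (d * c \<one>\<^bsub>N\<^esub> \<one>\<^bsub>N\<^esub>) w" using d(2) w(1) by (simp add: projective_rep_one)
    qed
    have Tk: "(?T ^^ k) w \<in> W" for k
      by (rule clinear_onD(1)[OF clinear_on_funpow[OF projective_rep_linear[OF \<mu>]] w(1)])
    have "\<exists>a. \<sigma> \<nu> (\<Sum>k<?m. s (z ^ k) ((?T ^^ k) w)) = s a (\<Sum>k<?m. s (z ^ k) ((?T ^^ k) w))"
      if \<nu>: "\<nu> \<in> F" for \<nu>
    proof -
      obtain a where a: "\<sigma> \<nu> w = s a w" using w(3) \<nu> by blast
      have \<nu>N: "\<nu> \<in> carrier N" using \<nu> F by blast
      have eig: "\<sigma> \<nu> ((?T ^^ k) w) = s a ((?T ^^ k) w)" for k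
      proof (induction k)
        case (Suc k)
        have "\<sigma> \<nu> ((?T ^^ Suc k) w) = ?T (\<sigma> \<nu> ((?T ^^ k) w))"
          using projective_rep_commute[OF \<nu>N \<mu> Tk, of k] insert.prems(2)[of \<nu> \<mu>] \<nu> by simp
        then show ?case by (simp add: Suc.IH projective_rep_scale[OF \<mu> Tk])
      qed (simp add: a)
      show ?thesis
        by (intro exI[of _ a], subst clinear_on_sum[OF projective_rep_linear[OF \<nu>N]
              projective_rep_cvector_space])
          (auto simp: subspace_scale[OF projective_rep_subspace Tk] projective_rep_scale[OF \<nu>N Tk] eig
            scale_sum_right mult.commute)
    qed
    moreover have "(\<Sum>k<?m. s (z ^ k) ((?T ^^ k) w)) \<in> W"
      by (intro subspace_sum[OF projective_rep_subspace] subspace_scale[OF projective_rep_subspace] Tk)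
    ultimately show ?case using z by (intro bexI[of _ "\<Sum>k<?m. s (z ^ k) ((?T ^^ k) w)"]) auto
  qed
  then obtain w where w: "w \<in> W" "w \<noteq> 0" and eig: "\<forall>\<mu>\<in>F. \<exists>a. \<sigma> \<mu> w = s a w" by blast
  \<comment> \<open>Eigenvalues cannot vanish, because each \<open>\<sigma> \<mu>\<close> is
    injective.\<close>
  have "a \<noteq> 0" if "\<mu> \<in> F" "\<sigma> \<mu> w = s a w" for \<mu> a
    using projective_rep_nonzero[of \<mu> w] that w assms(3) by auto
  with w eig show ?thesis by blast
qed

end

text \<open>Schur's lemma: kernel and image of \<open>T\<close> are invariant subspaces. The twist
  by the nonzero scalars \<open>l \<mu>\<close> does not affect invariance.\<close>

lemma irreducible_intertwiner_bij:
  assumes irr: "irreducible_rep N s W \<sigma>" "irreducible_rep N s' W' \<sigma>'"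
    and vs: "cvector_space s W" "cvector_space s' W'"
    and \<sigma>: "\<And>\<mu>. \<mu> \<in> carrier N \<Longrightarrow> clinear_on s W s W (\<sigma> \<mu>)"
    and \<sigma>': "\<And>\<mu>. \<mu> \<in> carrier N \<Longrightarrow> clinear_on s' W' s' W' (\<sigma>' \<mu>)"
    and T: "clinear_on s W s' W' T" and nz: "w0 \<in> W" "T w0 \<noteq> 0"
    and l: "\<And>\<mu>. \<mu> \<in> carrier N \<Longrightarrow> l \<mu> \<noteq> 0"
    and inter: "\<And>\<mu> w. \<mu> \<in> carrier N \<Longrightarrow> w \<in> W \<Longrightarrow> T (\<sigma> \<mu> w) = s' (l \<mu>) (\<sigma>' \<mu> (T w))"
  shows "bij_betw T W W'"
proof -
  interpret V: vector_space s using vs by (simp add: cvector_space_def)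
  interpret V': vector_space s' using vs by (simp add: cvector_space_def)
  have sub: "V.subspace W" "V'.subspace W'" using vs by (auto simp: cvector_space_def)
  let ?K = "{w \<in> W. T w = 0}"
  have "V.subspace ?K"
    by (auto simp: V.subspace_def clinear_on_zero[OF T vs(1)] clinear_onD[OF T] V.subspace_0[OF sub(1)]
        V.subspace_add[OF sub(1)] V.subspace_scale[OF sub(1)])
  moreover have "\<sigma> \<mu> ` ?K \<subseteq> ?K" if "\<mu> \<in> carrier N" for \<mu>
    using inter[OF that] clinear_onD(1)[OF \<sigma>[OF that]] clinear_on_zero[OF \<sigma>'[OF that] vs(2)] by auto
  ultimately have "?K = {0} \<or> ?K = W"
    using irr(1)[unfolded irreducible_rep_def, THEN conjunct2, rule_format, of ?K] by simp
  then have K: "?K = {0}" using nz by blast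
  have inj: "inj_on T W"
  proof (rule inj_onI)
    fix v w assume vw: "v \<in> W" "w \<in> W" "T v = T w"
    have "T (v - w) + T w = T v"
      using clinear_onD(2)[OF T, of "v - w" w] vw V.subspace_diff[OF sub(1)] by simp
    then have "v - w \<in> ?K" using vw V.subspace_diff[OF sub(1)] by simp
    then show "v = w" unfolding K by simp
  qed
  have "V'.subspace (T ` W)"
    unfolding V'.subspace_def
  proof (intro conjI ballI allI)
    show "0 \<in> T ` W" using clinear_on_zero[OF T vs(1)] V.subspace_0[OF sub(1)] by (metis imageI)
  next
    fix x y assume "x \<in> T ` W" "y \<in> T ` W"
    then show "x + y \<in> T ` W"
      using clinear_onD(2)[OF T] V.subspace_add[OF sub(1)] by (auto simp: image_iff) metis
  next
    fix a x assume "x \<in> T ` W"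
    then show "s' a x \<in> T ` W"
      using clinear_onD(3)[OF T] V.subspace_scale[OF sub(1)] by (auto simp: image_iff) metis
  qed
  moreover have "\<sigma>' \<mu> ` T ` W \<subseteq> T ` W" if \<mu>: "\<mu> \<in> carrier N" for \<mu>
  proof clarify
    fix w assume w: "w \<in> W"
    note \<sigma>w = clinear_onD(1)[OF \<sigma>[OF \<mu>] w]
    have "\<sigma>' \<mu> (T w) = T (s (inverse (l \<mu>)) (\<sigma> \<mu> w))"
      by (simp add: clinear_onD(3)[OF T \<sigma>w] inter[OF \<mu> w] l[OF \<mu>])
    then show "\<sigma>' \<mu> (T w) \<in> T ` W" using V.subspace_scale[OF sub(1) \<sigma>w] by simp
  qed
  moreover have "T ` W \<subseteq> W'" using T by (simp add: clinear_on_def)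
  ultimately have "T ` W = {0} \<or> T ` W = W'"
    using irr(2)[unfolded irreducible_rep_def, THEN conjunct2, rule_format, of "T ` W"] by simp
  then have "T ` W = W'" using nz by blast
  with inj show ?thesis by (simp add: bij_betw_def)
qed

text \<open>The intertwiner is easiest to define out of the free model space, whereas the claim asks
  for a map into it. Inverting the map inverts the scalars \<open>l\<close>.\<close>

lemma projectively_equivalentI_inverse:
  assumes vs: "cvector_space s W" "cvector_space s' W'"
    and \<sigma>: "\<And>\<mu>. \<mu> \<in> carrier N \<Longrightarrow> clinear_on s W s W (\<sigma> \<mu>)"
    and T: "clinear_iso s W s' W' T"
    and l: "\<And>\<mu>. \<mu> \<in> carrier N \<Longrightarrow> l \<mu> \<noteq> 0"
    and inter: "\<And>\<mu> w. \<mu> \<in> carrier N \<Longrightarrow> w \<in> W \<Longrightarrow> T (\<sigma> \<mu> w) = s' (l \<mu>) (\<sigma>' \<mu> (T w))"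
  shows "projectively_equivalent N s' W' \<sigma>' s W \<sigma>"
proof -
  interpret V: vector_space s using vs by (simp add: cvector_space_def)
  interpret V': vector_space s' using vs by (simp add: cvector_space_def)
  have sub: "V.subspace W" using vs by (auto simp: cvector_space_def)
  have Tl: "clinear_on s W s' W' T" and bij: "bij_betw T W W'" using T by (auto simp: clinear_iso_iff)
  let ?R = "inv_into W T"
  have R: "?R x \<in> W" "T (?R x) = x" if "x \<in> W'" for x
    using bij that by (auto simp: bij_betw_def intro: inv_into_into f_inv_into_f)
  have RT: "?R (T w) = w" if "w \<in> W" for w using bij that by (simp add: bij_betw_inv_into_left)
  have "clinear_iso s' W' s W ?R"
    unfolding clinear_iso_def
  proof (intro conjI ballI allI)
    show "bij_betw ?R W' W" by (rule bij_betw_inv_into[OF bij])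
    fix x y assume "x \<in> W'" "y \<in> W'"
    then show "?R (x + y) = ?R x + ?R y"
      using RT[of "?R x + ?R y"] R clinear_onD(2)[OF Tl, of "?R x" "?R y"] V.subspace_add[OF sub] by simp
  next
    fix a x assume "x \<in> W'"
    then show "?R (s' a x) = s a (?R x)"
      using RT[of "s a (?R x)"] R clinear_onD(3)[OF Tl, of "?R x"] V.subspace_scale[OF sub] by simp
  qed
  moreover have "?R (\<sigma>' \<mu> x) = s (inverse (l \<mu>)) (\<sigma> \<mu> (?R x))" if \<mu>: "\<mu> \<in> carrier N" and x: "x \<in> W'" for \<mu> x
  proof -
    note \<sigma>R = clinear_onD(1)[OF \<sigma>[OF \<mu>] R(1)[OF x]]
    have "T (s (inverse (l \<mu>)) (\<sigma> \<mu> (?R x))) = \<sigma>' \<mu> x"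
      by (simp add: clinear_onD(3)[OF Tl \<sigma>R] inter[OF \<mu> R(1)[OF x]] R(2)[OF x] l[OF \<mu>])
    then show ?thesis using RT[OF V.subspace_scale[OF sub \<sigma>R]] by metis
  qed
  ultimately show ?thesis
    unfolding projectively_equivalent_def
    using l by (intro exI[of _ ?R] exI[of _ "\<lambda>\<mu>. inverse (l \<mu>)"]) auto
qed

subsection \<open>Existence and uniqueness for a polarised group\<close>

context
  fixes N :: "('n, 'm) monoid_scheme" and G :: "('a, 'k) monoid_scheme"
    and \<gamma> :: "'n \<Rightarrow> 'a \<times> ('a \<Rightarrow> complex)" and C :: "'n \<Rightarrow> 'n \<Rightarrow> complex"
  assumes N: "comm_group N" and G: "group G" and \<gamma>: "\<gamma> \<in> iso N (G \<times>\<times> char_group G)"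
    and C: "\<And>\<mu> \<nu>. \<mu> \<in> carrier N \<Longrightarrow> \<nu> \<in> carrier N \<Longrightarrow>
      C \<mu> \<nu> = snd (\<gamma> \<nu>) (fst (\<gamma> \<mu>)) * inverse (snd (\<gamma> \<mu>) (fst (\<gamma> \<nu>)))"
begin

interpretation N: comm_group N by (rule N)
interpretation G: group G by (rule G)
interpretation D: comm_group "char_group G" by (rule comm_group_char_group[OF G])

private definition "pr1 \<mu> = fst (\<gamma> \<mu>)"
private definition "pr2 \<mu> = snd (\<gamma> \<mu>)"

private lemma pr_closed:
  assumes "\<mu> \<in> carrier N"
  shows "pr1 \<mu> \<in> carrier G" "pr2 \<mu> \<in> carrier (char_group G)"
proof -
  have "\<gamma> \<mu> \<in> carrier (G \<times>\<times> char_group G)"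
    using \<gamma> assms by (auto simp: iso_def hom_def)
  then show "pr1 \<mu> \<in> carrier G" "pr2 \<mu> \<in> carrier (char_group G)"
    by (auto simp: pr1_def pr2_def DirProd_def)
qed

private lemma pr_mult:
  assumes "\<mu> \<in> carrier N" "\<nu> \<in> carrier N"
  shows "pr1 (\<mu> \<otimes>\<^bsub>N\<^esub> \<nu>) = pr1 \<mu> \<otimes>\<^bsub>G\<^esub> pr1 \<nu>"
    "pr2 (\<mu> \<otimes>\<^bsub>N\<^esub> \<nu>) = pr2 \<mu> \<otimes>\<^bsub>char_group G\<^esub> pr2 \<nu>"
proof -
  have "\<gamma> (\<mu> \<otimes>\<^bsub>N\<^esub> \<nu>) = \<gamma> \<mu> \<otimes>\<^bsub>G \<times>\<times> char_group G\<^esub> \<gamma> \<nu>"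
    using \<gamma> assms by (simp add: iso_def hom_def)
  then show "pr1 (\<mu> \<otimes>\<^bsub>N\<^esub> \<nu>) = pr1 \<mu> \<otimes>\<^bsub>G\<^esub> pr1 \<nu>"
    "pr2 (\<mu> \<otimes>\<^bsub>N\<^esub> \<nu>) = pr2 \<mu> \<otimes>\<^bsub>char_group G\<^esub> pr2 \<nu>"
    by (cases "\<gamma> \<mu>", cases "\<gamma> \<nu>", simp add: pr1_def pr2_def)+
qed

private lemma pr_lift:
  assumes "x \<in> carrier G" "\<chi> \<in> carrier (char_group G)"
  obtains \<mu> where "\<mu> \<in> carrier N" "pr1 \<mu> = x" "pr2 \<mu> = \<chi>"
proof -
  have "(x, \<chi>) \<in> \<gamma> ` carrier N"
    using \<gamma> assms by (simp add: iso_def bij_betw_def DirProd_def)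
  then obtain \<mu> where "\<mu> \<in> carrier N" "\<gamma> \<mu> = (x, \<chi>)" by (metis imageE)
  then show thesis by (intro that[of \<mu>]) (simp_all add: pr1_def pr2_def)
qed

private lemma pr_inject:
  assumes "\<mu> \<in> carrier N" "\<nu> \<in> carrier N" "pr1 \<mu> = pr1 \<nu>" "pr2 \<mu> = pr2 \<nu>"
  shows "\<mu> = \<nu>"
proof -
  have "\<gamma> \<mu> = \<gamma> \<nu>" using assms(3,4) by (simp add: pr1_def pr2_def prod_eq_iff)
  moreover have "inj_on \<gamma> (carrier N)" using \<gamma> by (simp add: iso_def bij_betw_def)
  ultimately show ?thesis using assms(1,2) by (simp add: inj_on_eq_iff)
qed

private abbreviation (input) "\<rho> \<mu> \<equiv> rho0 G (\<gamma> \<mu>)"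
private abbreviation (input) "\<Omega> \<equiv> Omega0 G"
private abbreviation (input) "c0 \<mu> \<nu> \<equiv> pr2 \<nu> (pr1 \<mu>)"

private lemma \<rho>_eq: "\<rho> \<mu> = rho0 G (pr1 \<mu>, pr2 \<mu>)"
  by (simp add: pr1_def pr2_def)

private lemma \<rho>_linear: "\<mu> \<in> carrier N \<Longrightarrow> clinear_on fun_scale \<Omega> fun_scale \<Omega> (\<rho> \<mu>)"
  unfolding \<rho>_eq by (intro clinear_on_rho0 G pr_closed)

private lemma c0_nonzero: "\<mu> \<in> carrier N \<Longrightarrow> \<nu> \<in> carrier N \<Longrightarrow> c0 \<mu> \<nu> \<noteq> 0"
  by (rule char_closed[OF pr_closed(2) pr_closed(1)])

private lemma \<rho>_mult:
  "\<mu> \<in> carrier N \<Longrightarrow> \<nu> \<in> carrier N \<Longrightarrow> f \<in> \<Omega> \<Longrightarrow>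
    \<rho> \<mu> (\<rho> \<nu> f) = fun_scale (c0 \<mu> \<nu>) (\<rho> (\<mu> \<otimes>\<^bsub>N\<^esub> \<nu>) f)"
  unfolding \<rho>_eq pr_mult by (intro rho0_mult G pr_closed)

private lemma pr_one: "pr1 \<one>\<^bsub>N\<^esub> = \<one>\<^bsub>G\<^esub>" "pr2 \<one>\<^bsub>N\<^esub> = \<one>\<^bsub>char_group G\<^esub>"
  using pr_mult[of "\<one>\<^bsub>N\<^esub>" "\<one>\<^bsub>N\<^esub>"] pr_closed[of "\<one>\<^bsub>N\<^esub>"] by simp_all

private lemma \<rho>_one: "f \<in> \<Omega> \<Longrightarrow> \<rho> \<one>\<^bsub>N\<^esub> f = f"
  unfolding \<rho>_eq pr_one by (rule rho0_one[OF G])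

text \<open>The operators of \<mu> and its inverse compose to a nonzero scalar in either order, so a
  rescaled operator of the inverse is a two-sided inverse.\<close>

private lemma \<rho>_bij:
  assumes \<mu>: "\<mu> \<in> carrier N"
  shows "bij_betw (\<rho> \<mu>) \<Omega> \<Omega>"
proof -
  interpret vector_space fun_scale by (rule vector_space_fun_scale)
  have sub: "subspace \<Omega>" by (simp add: Omega0_def subspace_free_space)
  let ?\<mu>' = "inv\<^bsub>N\<^esub> \<mu>"
  have \<mu>': "?\<mu>' \<in> carrier N" using \<mu> by simp
  note nz = c0_nonzero[OF \<mu> \<mu>'] c0_nonzero[OF \<mu>' \<mu>]
  have r: "\<rho> ?\<mu>' (\<rho> \<mu> f) = fun_scale (c0 ?\<mu>' \<mu>) f" "\<rho> \<mu> (\<rho> ?\<mu>' f) = fun_scale (c0 \<mu> ?\<mu>') f"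
    if "f \<in> \<Omega>" for f
    using that \<mu> by (simp_all add: \<rho>_mult \<rho>_one)
  note cl = clinear_onD(1)[OF \<rho>_linear]
  \<comment> \<open>Bracketing \<rho>(\<mu>) \<rho>(\<mu>') \<rho>(\<mu>) f in two ways compares the
    scalars. The choice of \<open>f\<close> below makes \<rho>(\<mu>) f a nonzero multiple of a
    basis vector, so they can be cancelled.\<close>
  have c: "c0 ?\<mu>' \<mu> = c0 \<mu> ?\<mu>'"
  proof -
    have "fun_scale (c0 ?\<mu>' \<mu>) (\<rho> \<mu> f) = fun_scale (c0 \<mu> ?\<mu>') (\<rho> \<mu> f)" if "f \<in> \<Omega>" for f
      using r(2)[OF cl[OF \<mu> that]] r(1)[OF that] that clinear_onD(3)[OF \<rho>_linear[OF \<mu>]] by simp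
    from this[of "\<rho> ?\<mu>' (basis_vec \<one>\<^bsub>char_group G\<^esub>)"]
    have "fun_scale (c0 ?\<mu>' \<mu>) (basis_vec \<one>\<^bsub>char_group G\<^esub>)
      = fun_scale (c0 \<mu> ?\<mu>') (basis_vec \<one>\<^bsub>char_group G\<^esub>)"
      using r(2)[OF basis_vec_in_Omega0[OF G D.one_closed]] cl[OF \<mu>' basis_vec_in_Omega0[OF G D.one_closed]] nz
      by (metis scale_left_imp_eq scale_scale mult.commute scale_cancel_left)
    from fun_cong[OF this, of "\<one>\<^bsub>char_group G\<^esub>"] show ?thesis
      by (simp add: fun_scale_def basis_vec_def)
  qed
  show ?thesis
  proof (rule bij_betw_byWitness[where f' = "\<lambda>f. fun_scale (inverse (c0 \<mu> ?\<mu>')) (\<rho> ?\<mu>' f)"])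
    show "\<forall>f\<in>\<Omega>. fun_scale (inverse (c0 \<mu> ?\<mu>')) (\<rho> ?\<mu>' (\<rho> \<mu> f)) = f"
      using nz by (simp add: r c)
    show "\<forall>f\<in>\<Omega>. \<rho> \<mu> (fun_scale (inverse (c0 \<mu> ?\<mu>')) (\<rho> ?\<mu>' f)) = f"
      using nz by (simp add: clinear_onD(3)[OF \<rho>_linear[OF \<mu>]] cl[OF \<mu>'] r)
    show "\<rho> \<mu> ` \<Omega> \<subseteq> \<Omega>" using cl[OF \<mu>] by blast
    show "(\<lambda>f. fun_scale (inverse (c0 \<mu> ?\<mu>')) (\<rho> ?\<mu>' f)) ` \<Omega> \<subseteq> \<Omega>"
      using cl[OF \<mu>'] subspace_scale[OF sub] by blast
  qed
qed

text \<open>This cocycle is multiplicative in each argument, so both sides of the cocycle identity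
  expand to the same three factors.\<close>

lemma projective_rep_rho0: "projective_rep N c0 fun_scale \<Omega> \<rho>"
  unfolding projective_rep_def two_cocycle_def clinear_iso_iff
  using \<rho>_linear \<rho>_bij \<rho>_mult cvector_space_Omega0[OF G] c0_nonzero
  by (simp add: pr_mult pr_closed char_group_mult_apply char_mult)

lemma irreducible_rep_rho0: "irreducible_rep N fun_scale \<Omega> \<rho>"
  unfolding irreducible_rep_def
proof (intro conjI allI impI)
  show "\<Omega> \<noteq> {0}"
  proof
    assume "\<Omega> = {0}"
    then have "basis_vec \<one>\<^bsub>char_group G\<^esub> = (0 :: ('a \<Rightarrow> complex) \<Rightarrow> complex)"
      using basis_vec_in_Omega0[OF G D.one_closed] by blast
    from fun_cong[OF this, of "\<one>\<^bsub>char_group G\<^esub>"] show False by (simp add: basis_vec_def)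
  qed
next
  fix U assume U: "U \<subseteq> \<Omega>" "module.subspace fun_scale U \<and> (\<forall>\<mu>\<in>carrier N. \<rho> \<mu> ` U \<subseteq> U)"
  show "U = {0} \<or> U = \<Omega>"
  proof (rule rho0_irreducible[OF G _ U(1)])
    show "module.subspace fun_scale U" using U(2) by blast
    fix x \<chi> assume "x \<in> carrier G" "\<chi> \<in> carrier (char_group G)"
    then obtain \<mu> where \<mu>: "\<mu> \<in> carrier N" "pr1 \<mu> = x" "pr2 \<mu> = \<chi>" by (rule pr_lift)
    have "\<rho> \<mu> ` U \<subseteq> U" using U(2) \<mu>(1) by blast
    then show "rho0 G (x, \<chi>) ` U \<subseteq> U" by (simp add: \<rho>_eq \<mu>(2,3))
  qed
qed

lemma irreducible_projective_rep_rho0: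
  "irreducible_projective_rep_with_skew N C fun_scale \<Omega> \<rho>"
  unfolding irreducible_projective_rep_with_skew_def
proof (intro conjI exI[of _ "c0"])
  show "has_skew N c0 C" by (simp add: has_skew_def C pr1_def pr2_def divide_inverse)
qed (rule irreducible_rep_rho0 projective_rep_rho0)+

lemma irreducible_projective_rep_unique:
  fixes s :: "complex \<Rightarrow> 'w::ab_group_add \<Rightarrow> 'w"
  assumes fin: "finite (carrier N)" and irr: "irreducible_projective_rep_with_skew N C s W \<sigma>"
  shows "projectively_equivalent N s W \<sigma> fun_scale \<Omega> \<rho>"
proof -
  from irr obtain c where rep: "projective_rep N c s W \<sigma>" and skew: "has_skew N c C"
    and irrW: "irreducible_rep N s W \<sigma>"
    by (auto simp: irreducible_projective_rep_with_skew_def)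
  note rep_facts = N rep skew
  interpret vector_space s using rep by (simp add: projective_rep_def cvector_space_def)
  note sub = projective_rep_subspace[OF rep_facts]
  note vs = projective_rep_cvector_space[OF rep_facts]
  note \<sigma>_linear = projective_rep_linear[OF rep_facts]
  note \<sigma>_closed = projective_rep_closed[OF rep_facts]
  note \<sigma>_scale = projective_rep_scale[OF rep_facts]
  note \<sigma>_mult = projective_rep_mult[OF rep_facts]
  note c_nz = projective_rep_cocycle_nonzero[OF rep_facts]
  have W0: "W \<noteq> {0}" using irrW by (simp add: irreducible_rep_def)
  have Cpr: "C \<mu> \<nu> = pr2 \<nu> (pr1 \<mu>) * inverse (pr2 \<mu> (pr1 \<nu>))"
    if "\<mu> \<in> carrier N" "\<nu> \<in> carrier N" for \<mu> \<nu>
    using C[OF that] by (simp add: pr1_def pr2_def)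
  \<comment> \<open>\<open>\<alpha>\<close> and \<open>h\<close> embed \<open>G\<close> and its
    character group into \<open>N\<close> as the two summands.\<close>
  define \<alpha> where "\<alpha> x = (SOME \<mu>. \<mu> \<in> carrier N \<and> pr1 \<mu> = x \<and> pr2 \<mu> = \<one>\<^bsub>char_group G\<^esub>)" for x
  define h where "h \<chi> = (SOME \<mu>. \<mu> \<in> carrier N \<and> pr1 \<mu> = \<one>\<^bsub>G\<^esub> \<and> pr2 \<mu> = \<chi>)" for \<chi>
  have \<alpha>: "\<alpha> x \<in> carrier N" "pr1 (\<alpha> x) = x" "pr2 (\<alpha> x) = \<one>\<^bsub>char_group G\<^esub>"
    if x: "x \<in> carrier G" for x
  proof -
    have "\<exists>\<mu>. \<mu> \<in> carrier N \<and> pr1 \<mu> = x \<and> pr2 \<mu> = \<one>\<^bsub>char_group G\<^esub>"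
      by (rule pr_lift[OF x D.one_closed]) blast
    from someI_ex[OF this] show "\<alpha> x \<in> carrier N" "pr1 (\<alpha> x) = x" "pr2 (\<alpha> x) = \<one>\<^bsub>char_group G\<^esub>"
      unfolding \<alpha>_def by simp_all
  qed
  have h: "h \<chi> \<in> carrier N" "pr1 (h \<chi>) = \<one>\<^bsub>G\<^esub>" "pr2 (h \<chi>) = \<chi>"
    if \<chi>: "\<chi> \<in> carrier (char_group G)" for \<chi>
  proof -
    have "\<exists>\<mu>. \<mu> \<in> carrier N \<and> pr1 \<mu> = \<one>\<^bsub>G\<^esub> \<and> pr2 \<mu> = \<chi>"
      by (rule pr_lift[OF G.one_closed \<chi>]) blast
    from someI_ex[OF this] show "h \<chi> \<in> carrier N" "pr1 (h \<chi>) = \<one>\<^bsub>G\<^esub>" "pr2 (h \<chi>) = \<chi>"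
      unfolding h_def by simp_all
  qed
  have h_mult: "h \<chi> \<otimes>\<^bsub>N\<^esub> h \<psi> = h (\<chi> \<otimes>\<^bsub>char_group G\<^esub> \<psi>)"
    if "\<chi> \<in> carrier (char_group G)" "\<psi> \<in> carrier (char_group G)" for \<chi> \<psi>
    by (rule pr_inject) (use that in \<open>simp_all add: h pr_mult\<close>)
  \<comment> \<open>Hence \<open>\<sigma> \<mu>\<close> is determined, up to a cocycle value, by
    \<open>\<sigma>\<close> on the two summands.\<close>
  have decomp: "h (pr2 \<mu>) \<otimes>\<^bsub>N\<^esub> \<alpha> (pr1 \<mu>) = \<mu>" if "\<mu> \<in> carrier N" for \<mu>
    by (rule pr_inject) (use that in \<open>simp_all add: h \<alpha> pr_mult pr_closed\<close>)

  \<comment> \<open>Elements of the image of \<open>\<alpha>\<close> have trivial character part, so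
    both factors in \<open>Cpr\<close> are 1.\<close>
  have "\<exists>w\<in>W. w \<noteq> 0 \<and> (\<forall>\<mu>\<in>\<alpha> ` carrier G. \<exists>a. a \<noteq> 0 \<and> \<sigma> \<mu> w = s a w)"
  proof (rule joint_eigenvector[OF rep_facts fin W0])
    show "C \<mu> \<nu> = 1" if "\<mu> \<in> \<alpha> ` carrier G" "\<nu> \<in> \<alpha> ` carrier G" for \<mu> \<nu>
      using that by (auto simp: Cpr \<alpha> char_group_one_apply)
  qed (use \<alpha> in auto)
  then obtain w where w: "w \<in> W" "w \<noteq> 0"
    and "\<forall>x\<in>carrier G. \<exists>a. a \<noteq> 0 \<and> \<sigma> (\<alpha> x) w = s a w" by auto
  from bchoice[OF this(3)] obtain \<theta> where \<theta>0: "\<And>x. x \<in> carrier G \<Longrightarrow> \<theta> x \<noteq> 0"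
    and \<theta>: "\<And>x. x \<in> carrier G \<Longrightarrow> \<sigma> (\<alpha> x) w = s (\<theta> x) w" by auto
  \<comment> \<open>The eigenvalues of a joint eigenvector of the operators \<open>\<sigma> (h \<chi>)\<close> exhibit the cocycle on
    the characters as a coboundary.\<close>
  have "\<exists>u\<in>W. u \<noteq> 0 \<and> (\<forall>\<mu>\<in>h ` carrier (char_group G). \<exists>a. a \<noteq> 0 \<and> \<sigma> \<mu> u = s a u)"
  proof (rule joint_eigenvector[OF rep_facts fin W0])
    show "C \<mu> \<nu> = 1" if "\<mu> \<in> h ` carrier (char_group G)" "\<nu> \<in> h ` carrier (char_group G)" for \<mu> \<nu>
      using that by (auto simp: Cpr h char_one[OF G])
  qed (use h in auto)
  then obtain u where u: "u \<in> W" "u \<noteq> 0"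
    and "\<forall>\<chi>\<in>carrier (char_group G). \<exists>a. a \<noteq> 0 \<and> \<sigma> (h \<chi>) u = s a u" by auto
  from bchoice[OF this(3)] obtain \<kappa>
    where \<kappa>0: "\<And>\<chi>. \<chi> \<in> carrier (char_group G) \<Longrightarrow> \<kappa> \<chi> \<noteq> 0"
    and \<kappa>: "\<And>\<chi>. \<chi> \<in> carrier (char_group G) \<Longrightarrow> \<sigma> (h \<chi>) u = s (\<kappa> \<chi>) u" by auto
  have \<kappa>_mult: "\<kappa> \<chi> * \<kappa> \<psi> = c (h \<chi>) (h \<psi>) * \<kappa> (\<chi> \<otimes>\<^bsub>char_group G\<^esub> \<psi>)"
    if "\<chi> \<in> carrier (char_group G)" "\<psi> \<in> carrier (char_group G)" for \<chi> \<psi>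
  proof -
    have "s (\<kappa> \<chi> * \<kappa> \<psi>) u = \<sigma> (h \<chi>) (\<sigma> (h \<psi>) u)"
      using that u(1) by (simp add: \<kappa> \<sigma>_scale h mult.commute)
    also have "\<dots> = s (c (h \<chi>) (h \<psi>) * \<kappa> (\<chi> \<otimes>\<^bsub>char_group G\<^esub> \<psi>)) u"
      using \<sigma>_mult[OF h(1)[OF that(1)] h(1)[OF that(2)] u(1)] that by (simp add: h_mult \<kappa>)
    finally show ?thesis using u(2) by (simp add: scale_cancel_right)
  qed

  \<comment> \<open>\<open>v \<chi>\<close> is to be the image of \<open>basis_vec \<chi>\<close>.
    Dividing by \<open>\<kappa> \<chi>\<close> matters: otherwise \<open>\<sigma>h\<close> would
    contain a factor depending on \<psi>, which the scalars \<open>l \<mu>\<close> of an equivalence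
    cannot absorb.\<close>
  define v where "v \<chi> = s (inverse (\<kappa> \<chi>)) (\<sigma> (h \<chi>) w)" for \<chi>
  have v: "v \<chi> \<in> W" if "\<chi> \<in> carrier (char_group G)" for \<chi>
    unfolding v_def by (intro subspace_scale[OF sub] \<sigma>_closed h that w)
  have \<sigma>h: "\<sigma> (h \<chi>) (v \<psi>) = s (\<kappa> \<chi>) (v (\<chi> \<otimes>\<^bsub>char_group G\<^esub> \<psi>))"
    if "\<chi> \<in> carrier (char_group G)" "\<psi> \<in> carrier (char_group G)" for \<chi> \<psi>
  proof -
    have "\<sigma> (h \<chi>) (v \<psi>) = s (inverse (\<kappa> \<psi>) * c (h \<chi>) (h \<psi>)) (\<sigma> (h (\<chi> \<otimes>\<^bsub>char_group G\<^esub> \<psi>)) w)"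
      using that w(1) by (simp add: v_def \<sigma>_scale \<sigma>_closed \<sigma>_mult h h_mult)
    moreover have "inverse (\<kappa> \<psi>) * c (h \<chi>) (h \<psi>)
        = \<kappa> \<chi> * inverse (\<kappa> (\<chi> \<otimes>\<^bsub>char_group G\<^esub> \<psi>))"
      using \<kappa>_mult[OF that] \<kappa>0 that by (simp add: field_simps)
    ultimately show ?thesis by (simp add: v_def)
  qed
  \<comment> \<open>Moving \<open>\<sigma> (\<alpha> x)\<close> past
    \<open>\<sigma> (h \<psi>)\<close> costs the skew \<psi>(x). Then \<open>w\<close> contributes
    its eigenvalue \<open>\<theta> x\<close>.\<close>
  have \<sigma>\<alpha>: "\<sigma> (\<alpha> x) (v \<psi>) = s (\<theta> x * \<psi> x) (v \<psi>)"
    if "x \<in> carrier G" "\<psi> \<in> carrier (char_group G)" for x \<psi>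
  proof -
    have "C (\<alpha> x) (h \<psi>) = \<psi> x" using that by (simp add: Cpr \<alpha> h char_group_one_apply)
    then have "\<sigma> (\<alpha> x) (\<sigma> (h \<psi>) w) = s (\<psi> x) (\<sigma> (h \<psi>) (\<sigma> (\<alpha> x) w))"
      using projective_rep_commute[OF rep_facts \<alpha>(1)[OF that(1)] h(1)[OF that(2)] w(1)] by simp
    then show ?thesis
      using that w(1) by (simp add: v_def \<sigma>_scale \<sigma>_closed \<alpha> h \<theta> mult_ac)
  qed

  \<comment> \<open>The scalar between \<open>\<sigma> \<mu>\<close> and the model operator: the
    cocycle value from splitting \<mu> as in \<open>decomp\<close>, over the eigenvalues of the two
    parts.\<close>
  define l where "l \<mu> = c (h (pr2 \<mu>)) (\<alpha> (pr1 \<mu>)) / (\<kappa> (pr2 \<mu>) * \<theta> (pr1 \<mu>))" for \<mu>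
  have l0: "l \<mu> \<noteq> 0" if "\<mu> \<in> carrier N" for \<mu>
    using that by (simp add: l_def c_nz h \<alpha> pr_closed \<kappa>0 \<theta>0)
  have \<sigma>v: "s (l \<mu>) (\<sigma> \<mu> (v \<psi>)) = s (\<psi> (pr1 \<mu>)) (v (pr2 \<mu> \<otimes>\<^bsub>char_group G\<^esub> \<psi>))"
    if \<mu>: "\<mu> \<in> carrier N" and \<psi>: "\<psi> \<in> carrier (char_group G)" for \<mu> \<psi>
  proof -
    note pr = pr_closed[OF \<mu>]
    have "s (c (h (pr2 \<mu>)) (\<alpha> (pr1 \<mu>))) (\<sigma> \<mu> (v \<psi>)) = \<sigma> (h (pr2 \<mu>)) (\<sigma> (\<alpha> (pr1 \<mu>)) (v \<psi>))"
      using \<sigma>_mult[OF h(1)[OF pr(2)] \<alpha>(1)[OF pr(1)] v[OF \<psi>]] decomp[OF \<mu>] by simp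
    also have "\<dots> = s (\<theta> (pr1 \<mu>) * \<psi> (pr1 \<mu>) * \<kappa> (pr2 \<mu>)) (v (pr2 \<mu> \<otimes>\<^bsub>char_group G\<^esub> \<psi>))"
      by (simp add: \<sigma>\<alpha>[OF pr(1) \<psi>] \<sigma>_scale[OF h(1)[OF pr(2)] v[OF \<psi>]] \<sigma>h[OF pr(2) \<psi>])
    finally have eq: "s (c (h (pr2 \<mu>)) (\<alpha> (pr1 \<mu>))) (\<sigma> \<mu> (v \<psi>))
      = s (\<theta> (pr1 \<mu>) * \<psi> (pr1 \<mu>) * \<kappa> (pr2 \<mu>)) (v (pr2 \<mu> \<otimes>\<^bsub>char_group G\<^esub> \<psi>))" .
    have "s (l \<mu>) (\<sigma> \<mu> (v \<psi>)) = s (inverse (\<kappa> (pr2 \<mu>) * \<theta> (pr1 \<mu>)))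
        (s (c (h (pr2 \<mu>)) (\<alpha> (pr1 \<mu>))) (\<sigma> \<mu> (v \<psi>)))"
      by (simp add: l_def divide_inverse mult.commute)
    also have "\<dots> = s (\<psi> (pr1 \<mu>)) (v (pr2 \<mu> \<otimes>\<^bsub>char_group G\<^esub> \<psi>))"
      unfolding eq scale_scale using \<kappa>0[OF pr(2)] \<theta>0[OF pr(1)] by (simp add: field_simps)
    finally show ?thesis .
  qed

  define T where "T = free_lift s v"
  have T: "clinear_on fun_scale \<Omega> s W T"
    unfolding T_def Omega0_def by (rule clinear_on_free_lift[OF vs v])
  have Te: "T (basis_vec \<chi>) = v \<chi>" for \<chi>
    unfolding T_def by (rule free_lift_basis_vec) (rule vector_space_axioms)
  have inter: "T (\<rho> \<mu> f) = s (l \<mu>) (\<sigma> \<mu> (T f))" if \<mu>: "\<mu> \<in> carrier N" and f: "f \<in> \<Omega>" for \<mu> f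
  proof (rule clinear_on_Omega0_eqI[OF G _ _ _ f, where T = "\<lambda>f. T (\<rho> \<mu> f)"
        and T' = "\<lambda>f. s (l \<mu>) (\<sigma> \<mu> (T f))"])
    show "clinear_on fun_scale \<Omega> s W (\<lambda>f. T (\<rho> \<mu> f))"
      by (rule clinear_on_compose[OF \<rho>_linear[OF \<mu>] T])
    show "clinear_on fun_scale \<Omega> s W (\<lambda>f. s (l \<mu>) (\<sigma> \<mu> (T f)))"
      by (rule clinear_on_scale[OF clinear_on_compose[OF T \<sigma>_linear[OF \<mu>]] vs])
    fix \<psi> assume \<psi>: "\<psi> \<in> carrier (char_group G)"
    note pr = pr_closed[OF \<mu>]
    have "T (\<rho> \<mu> (basis_vec \<psi>)) = s (\<psi> (pr1 \<mu>)) (v (pr2 \<mu> \<otimes>\<^bsub>char_group G\<^esub> \<psi>))"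
      unfolding \<rho>_eq rho0_basis_vec
      by (simp add: clinear_onD(3)[OF T] basis_vec_in_Omega0[OF G] pr \<psi> Te)
    then show "T (\<rho> \<mu> (basis_vec \<psi>)) = s (l \<mu>) (\<sigma> \<mu> (T (basis_vec \<psi>)))"
      unfolding Te \<sigma>v[OF \<mu> \<psi>] .
  qed
  let ?e = "basis_vec \<one>\<^bsub>char_group G\<^esub> :: ('a \<Rightarrow> complex) \<Rightarrow> complex"
  have "v \<one>\<^bsub>char_group G\<^esub> \<noteq> 0"
    unfolding v_def using projective_rep_nonzero[OF rep_facts h(1)[OF D.one_closed] w]
      \<kappa>0[OF D.one_closed] by simp
  then have nz: "T ?e \<noteq> 0" by (simp add: Te)
  \<comment> \<open>Irreducibility of the model gives injectivity, and that of
    \<open>\<sigma>\<close> gives surjectivity.\<close>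
  have bij: "bij_betw T \<Omega> W"
    by (rule irreducible_intertwiner_bij[where N = N and \<sigma> = \<rho> and \<sigma>' = \<sigma> and l = l and s = fun_scale
          and s' = s, OF irreducible_rep_rho0 irrW cvector_space_Omega0[OF G] vs \<rho>_linear \<sigma>_linear T
          basis_vec_in_Omega0[OF G D.one_closed] nz l0 inter])
  show ?thesis
    by (rule projectively_equivalentI_inverse[where \<sigma> = \<rho> and T = T and l = l,
          OF cvector_space_Omega0[OF G] vs \<rho>_linear _ l0 inter])
      (simp_all add: clinear_iso_iff T bij)
qed

end

subsection \<open>Finiteness of \<open>L\<^sub>g\<^sup>\<bottom> / L(1 - g)\<close>\<close>

context
  fixes b :: "'v::real_vector \<Rightarrow> 'v \<Rightarrow> real" and L :: "'v set" and g :: "'v \<Rightarrow> 'v" and n :: nat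
  assumes lat: "is_lattice b L" and aut: "lattice_aut b L g" and gn: "has_order g n"
begin

private lemma b_linear: "linear (b x)" using lat by (simp add: is_lattice_def)
private lemma b_sym: "b x y = b y x" using lat by (simp add: is_lattice_def)
private lemma g_linear: "linear g" using aut by (simp add: lattice_aut_def)
private lemma g_closed: "x \<in> L \<Longrightarrow> g x \<in> L" using aut by (auto simp: lattice_aut_def)
private lemma g_isometry: "b (g x) (g y) = b x y" using aut by (simp add: lattice_aut_def)
private lemma n_pos: "0 < n" and g_order: "g ^^ n = id" using gn by (auto simp: has_order_def)

private lemma b_left: "b (x + y) z = b x z + b y z" "b (x - y) z = b x z - b y z"
    "b (a *\<^sub>R x) z = a * b x z" "b 0 z = 0" "b (- x) z = - b x z"
  using linear_add[OF b_linear, of z] linear_diff[OF b_linear, of z] linear_scale[OF b_linear, of z]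
    linear_0[OF b_linear, of z] linear_neg[OF b_linear, of z] by (simp_all add: b_sym[of _ z])

private lemma b_sum: "b z (\<Sum>i\<in>I. f i) = (\<Sum>i\<in>I. b z (f i))"
  by (rule linear_sum[OF b_linear])

private lemma gk_closed: "x \<in> L \<Longrightarrow> (g ^^ k) x \<in> L"
  by (induction k) (auto simp: g_closed)

private lemma gk_isometry: "b ((g ^^ k) x) ((g ^^ k) y) = b x y"
  by (induction k) (auto simp: g_isometry)

private lemma gk_fixed: "g v = v \<Longrightarrow> (g ^^ k) v = v"
  by (induction k) auto

private abbreviation (input) "K \<equiv> coinvariant_lattice b L g"
private abbreviation (input) "H \<equiv> (\<lambda>\<alpha>. \<alpha> - g \<alpha>) ` L"

private lemma L_diff: "x \<in> L \<Longrightarrow> y \<in> L \<Longrightarrow> x - y \<in> L"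
  using lattice_add[OF lat, of x "- y"] lattice_minus[OF lat, of y] by simp

private lemma L_sum: "(\<And>i. i \<in> I \<Longrightarrow> f i \<in> L) \<Longrightarrow> (\<Sum>i\<in>I. f i) \<in> L"
  by (induction I rule: infinite_finite_induct) (auto intro: lattice_zero[OF lat] lattice_add[OF lat])

lemma comm_group_add_group_coinvariant: "comm_group (add_group K)"
proof (rule comm_groupI)
  fix x assume "x \<in> carrier (add_group K)"
  then show "\<exists>y\<in>carrier (add_group K). y \<otimes>\<^bsub>add_group K\<^esub> x = \<one>\<^bsub>add_group K\<^esub>"
    by (intro bexI[of _ "- x"])
      (auto simp: add_group_def coinvariant_lattice_def b_left lattice_minus[OF lat])
qed (auto simp: add_group_def coinvariant_lattice_def b_left lattice_zero[OF lat] lattice_add[OF lat])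

lemma subgroup_coboundaries: "subgroup H (add_group K)"
proof -
  interpret comm_group "add_group K" by (rule comm_group_add_group_coinvariant)
  \<comment> \<open>For fixed v, isometry gives b(g \<alpha>, v) = b(g \<alpha>, g v) = b(\<alpha>,
    v), so \<alpha> - g \<alpha> is orthogonal to v.\<close>
  have HK: "H \<subseteq> K"
    using g_isometry by (auto simp: coinvariant_lattice_def b_left intro!: L_diff g_closed) (metis diff_self)
  show ?thesis
  proof (rule subgroupI)
    show "H \<subseteq> carrier (add_group K)" using HK by (simp add: add_group_def)
    show "H \<noteq> {}" using lattice_zero[OF lat] by blast
  next
    fix x assume x: "x \<in> H"
    then obtain \<alpha> where "\<alpha> \<in> L" "x = \<alpha> - g \<alpha>" by blast
    then have "- x \<in> H"
      using linear_neg[OF g_linear] by (intro image_eqI[of _ _ "- \<alpha>"]) (auto simp: lattice_minus[OF lat])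
    moreover have "inv\<^bsub>add_group K\<^esub> x = - x"
      by (rule inv_equality) (use x calculation HK in \<open>auto simp: add_group_def\<close>)
    ultimately show "inv\<^bsub>add_group K\<^esub> x \<in> H" by simp
  next
    fix x y assume "x \<in> H" "y \<in> H"
    then obtain \<alpha> \<beta> where "\<alpha> \<in> L" "x = \<alpha> - g \<alpha>" "\<beta> \<in> L" "y = \<beta> - g \<beta>" by blast
    then show "x \<otimes>\<^bsub>add_group K\<^esub> y \<in> H"
      using linear_add[OF g_linear]
      by (intro image_eqI[of _ _ "\<alpha> + \<beta>"]) (auto simp: add_group_def lattice_add[OF lat])
  qed
qed

lemma comm_group_N_group: "comm_group (N_group b L g)"
  unfolding N_group_def
  by (rule comm_group.abelian_FactGroup[OF comm_group_add_group_coinvariant subgroup_coboundaries])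

section \<open>The orbit sum and the exponent of the quotient\<close>

private lemma orbit_sum_fixed: "g (\<Sum>k<n. (g ^^ k) x) = (\<Sum>k<n. (g ^^ k) x)"
proof -
  have "g (\<Sum>k<n. (g ^^ k) x) = (\<Sum>k<n. (g ^^ Suc k) x)" by (simp add: linear_sum[OF g_linear])
  also have "\<dots> = (\<Sum>k<n. (g ^^ k) x)"
    using sum.lessThan_Suc_shift[of "\<lambda>k. (g ^^ k) x" n] sum.lessThan_Suc[of "\<lambda>k. (g ^^ k) x" n] g_order
    by (simp add: add.commute)
  finally show ?thesis .
qed

private lemma orbit_sum_fixed_form:
  assumes "g v = v"
  shows "b v (\<Sum>k<n. (g ^^ k) x) = real n * b v x"
proof -
  have "b v ((g ^^ k) x) = b v x" for k
    using gk_isometry[of k v x] by (simp add: gk_fixed[OF assms])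
  then show ?thesis by (simp add: b_sum)
qed

text \<open>Evaluating the form on the orbit sums of \<alpha> and y, with either one as the fixed
  vector, gives n b(s \<alpha>, y) = n b(s y, \<alpha>), where s is the orbit sum. The right side
  vanishes because s y is fixed, and non-degeneracy finishes.\<close>

private lemma orbit_sum_zero:
  assumes "\<alpha> \<in> K"
  shows "(\<Sum>k<n. (g ^^ k) \<alpha>) = 0"
proof -
  let ?s = "\<lambda>x. \<Sum>k<n. (g ^^ k) x"
  have "b (?s \<alpha>) y = 0" for y
  proof -
    have "real n * b (?s \<alpha>) y = b (?s y) (?s \<alpha>)"
      using orbit_sum_fixed_form[OF orbit_sum_fixed] by (metis b_sym)
    also have "\<dots> = real n * b (?s y) \<alpha>" by (rule orbit_sum_fixed_form[OF orbit_sum_fixed])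
    also have "b (?s y) \<alpha> = 0"
      using assms orbit_sum_fixed by (simp add: coinvariant_lattice_def b_sym[of _ \<alpha>])
    finally show ?thesis using n_pos by simp
  qed
  then show ?thesis using lat by (simp add: is_lattice_def)
qed

text \<open>Telescoping: 1 - g applied to the sum of g^j \<alpha> over j < k is \<alpha> - g^k
  \<alpha>. Summing over k < n leaves n \<alpha> minus the orbit sum, which is zero.\<close>

private lemma order_kills_N:
  assumes "\<alpha> \<in> K"
  shows "real n *\<^sub>R \<alpha> \<in> H"
proof
  let ?e = "\<Sum>k<n. \<Sum>j<k. (g ^^ j) \<alpha>"
  have "\<alpha> \<in> L" using assms by (simp add: coinvariant_lattice_def)
  then show "?e \<in> L" by (intro L_sum gk_closed)
  have "(\<Sum>j<k. (g ^^ j) \<alpha>) - g (\<Sum>j<k. (g ^^ j) \<alpha>) = \<alpha> - (g ^^ k) \<alpha>" for k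
    using sum_lessThan_telescope'[of "\<lambda>j. (g ^^ j) \<alpha>" k]
    by (simp add: linear_sum[OF g_linear] sum_subtractf)
  then have "?e - g ?e = (\<Sum>k<n. \<alpha> - (g ^^ k) \<alpha>)"
    by (simp add: linear_sum[OF g_linear] sum_subtractf[symmetric])
  also have "\<dots> = real n *\<^sub>R \<alpha>"
    using orbit_sum_zero[OF assms] by (simp add: sum_subtractf sum_constant_scaleR)
  finally show "real n *\<^sub>R \<alpha> = ?e - g ?e" ..
qed

text \<open>A coset is determined by the coordinates mod \<open>n\<close> of a representative, and
  there are finitely many residue vectors.\<close>

lemma finite_N_group: "finite (carrier (N_group b L g))"
proof -
  interpret comm_group "add_group K" by (rule comm_group_add_group_coinvariant)
  obtain B where B: "finite B" and L: "L = {\<Sum>v\<in>B. of_int (c v) *\<^sub>R v | c :: 'v \<Rightarrow> int. True}"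
    using lat unfolding is_lattice_def by blast
  have "\<forall>x\<in>L. \<exists>c :: 'v \<Rightarrow> int. x = (\<Sum>v\<in>B. of_int (c v) *\<^sub>R v)" unfolding L by blast
  then obtain c :: "'v \<Rightarrow> 'v \<Rightarrow> int" where c: "\<And>x. x \<in> L \<Longrightarrow> x = (\<Sum>v\<in>B. of_int (c x v) *\<^sub>R v)"
    by metis
  define q where "q \<alpha> = H #>\<^bsub>add_group K\<^esub> \<alpha>" for \<alpha>
  define r where "r \<alpha> = (\<lambda>v\<in>B. c \<alpha> v mod int n)" for \<alpha>
  have "r ` K \<subseteq> B \<rightarrow>\<^sub>E {0..<int n}" using n_pos by (auto simp: r_def)
  then have fin: "finite (r ` K)" by (rule finite_subset) (simp add: finite_PiE B)
  have q: "q \<alpha> = q \<beta>" if \<alpha>: "\<alpha> \<in> K" and \<beta>: "\<beta> \<in> K" and eq: "r \<alpha> = r \<beta>" for \<alpha> \<beta>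
  proof -
    \<comment> \<open>Equal residues make \<alpha> - \<beta> an \<open>n\<close>-fold multiple of
      this lattice vector.\<close>
    define \<delta> where "\<delta> = (\<Sum>v\<in>B. of_int ((c \<alpha> v - c \<beta> v) div int n) *\<^sub>R v)"
    have \<alpha>\<beta>: "\<alpha> \<in> L" "\<beta> \<in> L" using \<alpha> \<beta> by (auto simp: coinvariant_lattice_def)
    have dvd: "int n * ((c \<alpha> v - c \<beta> v) div int n) = c \<alpha> v - c \<beta> v" if "v \<in> B" for v
      using fun_cong[OF eq, of v] that by (simp add: r_def mod_eq_dvd_iff)
    have "real n *\<^sub>R \<delta> = (\<Sum>v\<in>B. of_int (int n * ((c \<alpha> v - c \<beta> v) div int n)) *\<^sub>R v)"
      by (simp add: \<delta>_def scaleR_sum_right)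
    also have "\<dots> = (\<Sum>v\<in>B. of_int (c \<alpha> v) *\<^sub>R v) - (\<Sum>v\<in>B. of_int (c \<beta> v) *\<^sub>R v)"
      by (simp add: dvd scaleR_left_diff_distrib sum_subtractf)
    also have "\<dots> = \<alpha> - \<beta>" using c[OF \<alpha>\<beta>(1)] c[OF \<alpha>\<beta>(2)] by simp
    finally have \<delta>: "real n *\<^sub>R \<delta> = \<alpha> - \<beta>" .
    \<comment> \<open>Primitivity of \<open>K\<close>: it is cut out of \<open>L\<close> by real
      linear equations, so a lattice vector lies in \<open>K\<close> as soon as its
      \<open>n\<close>-fold multiple does.\<close>
    have "b \<delta> v = 0" if "g v = v" for v
    proof -
      have "real n * b \<delta> v = b \<alpha> v - b \<beta> v" by (simp only: b_left[symmetric] \<delta>)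
      then show ?thesis using \<alpha> \<beta> that n_pos by (simp add: coinvariant_lattice_def)
    qed
    moreover have "\<delta> \<in> L" unfolding L \<delta>_def
      by (intro CollectI exI[of _ "\<lambda>v. (c \<alpha> v - c \<beta> v) div int n"]) simp
    ultimately have "\<alpha> - \<beta> \<in> H"
      using order_kills_N[of \<delta>] \<delta> by (simp add: coinvariant_lattice_def)
    then have "\<alpha> \<in> H #>\<^bsub>add_group K\<^esub> \<beta>"
      unfolding r_coset_def by (intro UN_I[of "\<alpha> - \<beta>"]) (simp_all add: add_group_def)
    then show ?thesis
      unfolding q_def using repr_independence[OF _ _ subgroup_coboundaries, of \<alpha> \<beta>] \<beta>
      by (simp add: add_group_def)
  qed
  \<comment> \<open>The coset map factors through \<open>r\<close>, with \<open>inv_into\<close>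
    selecting one representative for each residue vector.\<close>
  have "q ` K \<subseteq> (\<lambda>t. q (inv_into K r t)) ` r ` K"
  proof
    fix x assume "x \<in> q ` K"
    then obtain \<alpha> where \<alpha>: "\<alpha> \<in> K" "x = q \<alpha>" by blast
    then have "x = q (inv_into K r (r \<alpha>))"
      using q[of \<alpha> "inv_into K r (r \<alpha>)"] by (simp add: inv_into_into f_inv_into_f)
    with \<alpha>(1) show "x \<in> (\<lambda>t. q (inv_into K r t)) ` r ` K" by blast
  qed
  then have "finite (q ` K)" using fin by (rule finite_subset[OF _ finite_imageI])
  then show ?thesis
    by (simp add: N_group_def carrier_FactGroup q_def[abs_def] add_group_def)
qed

end

theorem theorem5p1:
  fixes b :: "'v::real_vector \<Rightarrow> 'v \<Rightarrow> real"
    and L :: "'v set"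
    and g :: "'v \<Rightarrow> 'v"
    and n :: nat
    and \<xi> :: complex
    and A :: "'v set set"
    and \<gamma> :: "'v set \<Rightarrow> 'v set \<times> ('v set \<Rightarrow> complex)"
  defines "N \<equiv> N_group b L g"
  defines "C \<equiv> C_form b g n \<xi>"
  defines "GA \<equiv> N\<lparr>carrier := A\<rparr>"
  defines "\<rho> \<equiv> (\<lambda>\<mu>. rho0 GA (\<gamma> \<mu>))"
  assumes "even_lattice b L" and "unimodular b L"
    and "lattice_aut b L g" and "has_order g n"
    and "primitive_root_of_unity n \<xi>"
    and "subgroup A N"
    and "\<gamma> \<in> iso N (GA \<times>\<times> char_group GA)"
    and "\<And>x y \<chi> \<psi>. x \<in> A \<Longrightarrow> y \<in> A \<Longrightarrow>
           \<chi> \<in> carrier (char_group GA) \<Longrightarrow> \<psi> \<in> carrier (char_group GA) \<Longrightarrow>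
           C (inv_into (carrier N) \<gamma> (x, \<chi>)) (inv_into (carrier N) \<gamma> (y, \<psi>))
             = \<psi> x * inverse (\<chi> y)"
  shows "irreducible_projective_rep_with_skew N C fun_scale (Omega0 GA) \<rho> \<and>
    (\<forall>x\<in>A. \<forall>\<chi>\<in>carrier (char_group GA). \<forall>\<psi>\<in>carrier (char_group GA).
       \<rho> (inv_into (carrier N) \<gamma> (x, \<chi>)) (basis_vec \<psi>)
         = fun_scale (\<psi> x) (basis_vec (\<chi> \<otimes>\<^bsub>char_group GA\<^esub> \<psi>))) \<and>
    (\<forall>(s :: complex \<Rightarrow> 'w::ab_group_add \<Rightarrow> 'w) W \<sigma>.
       irreducible_projective_rep_with_skew N C s W \<sigma> \<longrightarrow>
       projectively_equivalent N s W \<sigma> fun_scale (Omega0 GA) \<rho>)"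
proof -
  have lat: "is_lattice b L" using \<open>even_lattice b L\<close> by (simp add: even_lattice_def)
  have N: "comm_group N"
    unfolding N_def by (rule comm_group_N_group[OF lat \<open>lattice_aut b L g\<close> \<open>has_order g n\<close>])
  have fin: "finite (carrier N)"
    unfolding N_def by (rule finite_N_group[OF lat \<open>lattice_aut b L g\<close> \<open>has_order g n\<close>])
  have GA: "group GA"
    unfolding GA_def using \<open>subgroup A N\<close> N by (simp add: subgroup.subgroup_is_group comm_group.axioms)
  note \<gamma> = \<open>\<gamma> \<in> iso N (GA \<times>\<times> char_group GA)\<close>
  then have bij: "bij_betw \<gamma> (carrier N) (A \<times> carrier (char_group GA))"
    by (simp add: iso_def DirProd_def GA_def)
  \<comment> \<open>The assumption on \<open>C\<close> is phrased through the inverse of \<gamma>.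
    Writing \<mu> and \<nu> as preimages of their own images turns it into a formula on
    \<open>N\<close>.\<close>
  have C: "C \<mu> \<nu> = snd (\<gamma> \<nu>) (fst (\<gamma> \<mu>)) * inverse (snd (\<gamma> \<mu>) (fst (\<gamma> \<nu>)))"
    if "\<mu> \<in> carrier N" "\<nu> \<in> carrier N" for \<mu> \<nu>
  proof -
    have "\<gamma> \<mu> \<in> A \<times> carrier (char_group GA)" "\<gamma> \<nu> \<in> A \<times> carrier (char_group GA)"
      using bij that by (auto simp: bij_betw_def)
    then show ?thesis
      using assms(12)[of "fst (\<gamma> \<mu>)" "fst (\<gamma> \<nu>)" "snd (\<gamma> \<mu>)" "snd (\<gamma> \<nu>)"] that
        bij_betw_inv_into_left[OF bij] by (auto simp: mem_Times_iff)
  qed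
  have "\<rho> (inv_into (carrier N) \<gamma> (x, \<chi>)) (basis_vec \<psi>)
      = fun_scale (\<psi> x) (basis_vec (\<chi> \<otimes>\<^bsub>char_group GA\<^esub> \<psi>))"
    if "x \<in> A" "\<chi> \<in> carrier (char_group GA)" for x \<chi> \<psi>
    using bij_betw_inv_into_right[OF bij, of "(x, \<chi>)"] that by (simp add: \<rho>_def rho0_basis_vec)
  then show ?thesis
    using irreducible_projective_rep_rho0[OF N GA \<gamma> C]
      irreducible_projective_rep_unique[OF N GA \<gamma> C fin, folded \<rho>_def]
    unfolding \<rho>_def by blast
qed

end
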